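(* Let $N\ge2$ be an integer. Assume that for all $1\le j,\ell\le N-1$ the following four identities hold (the first only being required when $j\ne\ell$): $$\sum_{i=1}^{N-1}\frac{2i+1}{\lambda_i}(\mathcal W^{ij\ell})^2=\frac{1}{N|j-\ell|(j+\ell+1)}\quad (j\neq\ell),$$ $$\sum_{i=1}^{N-1}(-1)^i\lambda_i(2i+1)(\mathcal W^{ij\ell})^2=(-1)^{N+1}(\lambda_j+\lambda_\ell)\mathcal W^\ell_j,$$ $$\sum_{i=1}^{N-1}\lambda_i(2i+1)(\mathcal W^{ij\ell})^2=\frac{(N^2-1)(\lambda_j+\lambda_\ell)-2\lambda_j\lambda_\ell}{N(N^2-1)},$$ $$\sum_{i=1}^{N-1}\frac{2i+1}{\lambda_i}\left(\frac1N+(-1)^{i+j+N}\mathcal W^i_j\right)=\frac{2H_j}{N}.$$ Then for every $1\le\ell\le N-1$, $$r_\ell(N)^-=\frac{2(H_\ell-1)}{\hbar_N^2}=2(H_\ell-1)\left(\frac{N^2-1}{4}\right),\qquad r_\ell(N)^+\le(4H_\ell+2\ell+1)\left(\frac{N^2-1}{4}\right).$$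
   Context: Notation: $\lambda_i=i(i+1)$, $\hbar_N=2/\sqrt{N^2-1}$, $H_j=1+\frac12+\cdots+\frac1j$ is the $j$-th harmonic number. With $\{:::\}$ the Wigner $6j$ symbol (equal to $0$ if its triangle conditions fail), for fixed $N$ write $$\mathcal W^{ij\ell}=\left\{\begin{matrix}i&j&\ell\\ \frac{N-1}{2}&\frac{N-1}{2}&\frac{N-1}{2}\end{matrix}\right\},\qquad \mathcal W^i_j=\left\{\begin{matrix}i&\frac{N-1}{2}&\frac{N-1}{2}\\ j&\frac{N-1}{2}&\frac{N-1}{2}\end{matrix}\right\}.$$ For $1\le\ell\le N-1$ define $$r_\ell(N)^+=\frac{N}{\hbar_N^2}\sum_{\substack{k,k'=1\\ k+k'+\ell\ \mathrm{odd}}}^{N-1}\frac{\lambda_\ell}{\lambda_k\lambda_{k'}}(2k+1)(2k'+1)(\mathcal W^{\ell kk'})^2,$$ $$r_\ell(N)^-=\frac{N}{\hbar_N^2}\sum_{\substack{k,k'=1\\ k+k'+\ell\ \mathrm{odd}}}^{N-1}\frac{(\lambda_k-\lambda_{k'})^2}{\lambda_k\lambda_{k'}\lambda_\ell}(2k+1)(2k'+1)(\mathcal W^{\ell kk'})^2 .$$ These are the positive and negative parts of the Ricci curvature of $SU(N)$ with the Zeitlin metric on the subspace $V_\ell$ of $\mathfrak{su}(N)$ (the eigenspace of the quantized Laplacian with eigenvalue $-\ell(\ell+1)$). *)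

theory Defs
  imports "HOL-Analysis.Harmonic_Numbers"
begin

text \<open>
  Angular momenta lie in \<open>{0, 1/2, 1, 3/2, \<dots>}\<close> and are encoded by their doubles: an argument
  \<open>a :: nat\<close> of the three constants below stands for the angular momentum \<open>a / 2\<close>. Under
  \<open>triad a b c\<close> every \<open>div 2\<close> in \<open>triangle_coeff\<close> is exact and no subtraction truncates.
\<close>

definition triad :: "nat \<Rightarrow> nat \<Rightarrow> nat \<Rightarrow> bool" where
  "triad a b c \<longleftrightarrow> even (a + b + c) \<and> a \<le> b + c \<and> b \<le> a + c \<and> c \<le> a + b"

definition triangle_coeff :: "nat \<Rightarrow> nat \<Rightarrow> nat \<Rightarrow> real" where
  "triangle_coeff a b c =
     sqrt (fact ((a + b - c) div 2) * fact ((a + c - b) div 2) * fact ((b + c - a) div 2)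
           / fact ((a + b + c) div 2 + 1))"

text \<open>
  \<open>wigner_6j a b c d e f\<close> is the symbol with upper row \<open>a/2, b/2, c/2\<close> and lower row
  \<open>d/2, e/2, f/2\<close>, given by Racah's formula. The four triads are the upper row and the upper row
  with two of its entries replaced by the lower entries of the same columns. The summation
  variable \<open>t\<close> runs over exactly the integers for which all factorial arguments are nonnegative.
\<close>

definition wigner_6j :: "nat \<Rightarrow> nat \<Rightarrow> nat \<Rightarrow> nat \<Rightarrow> nat \<Rightarrow> nat \<Rightarrow> real" where
  "wigner_6j a b c d e f =
    (if triad a b c \<and> triad a e f \<and> triad d b f \<and> triad d e c then
       let p1 = (a + b + c) div 2; p2 = (a + e + f) div 2;
           p3 = (d + b + f) div 2; p4 = (d + e + c) div 2;
           q1 = (a + b + d + e) div 2; q2 = (b + c + e + f) div 2; q3 = (a + c + d + f) div 2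
       in triangle_coeff a b c * triangle_coeff a e f * triangle_coeff d b f * triangle_coeff d e c *
          (\<Sum>t = max (max p1 p2) (max p3 p4)..min q1 (min q2 q3).
             (-1) ^ t * fact (t + 1) /
             (fact (t - p1) * fact (t - p2) * fact (t - p3) * fact (t - p4)
              * fact (q1 - t) * fact (q2 - t) * fact (q3 - t)))
     else 0)"

definition lam :: "nat \<Rightarrow> real" where
  "lam i = real i * (real i + 1)"

definition hbar :: "nat \<Rightarrow> real" where
  "hbar N = 2 / sqrt ((real N)\<^sup>2 - 1)"

text \<open>Entries equal to \<open>(N - 1)/2\<close> are encoded as \<open>N - 1\<close>, integers \<open>i\<close> as \<open>2 * i\<close>.\<close>

definition W3 :: "nat \<Rightarrow> nat \<Rightarrow> nat \<Rightarrow> nat \<Rightarrow> real" where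
  "W3 N i j l = wigner_6j (2 * i) (2 * j) (2 * l) (N - 1) (N - 1) (N - 1)"

definition W2 :: "nat \<Rightarrow> nat \<Rightarrow> nat \<Rightarrow> real" where
  "W2 N i j = wigner_6j (2 * i) (N - 1) (N - 1) (2 * j) (N - 1) (N - 1)"

definition ricci_pos :: "nat \<Rightarrow> nat \<Rightarrow> real" where
  "ricci_pos N l = real N / (hbar N)\<^sup>2 *
     (\<Sum>k = 1..N - 1. \<Sum>k' \<in> {k' \<in> {1..N - 1}. odd (k + k' + l)}.
        lam l / (lam k * lam k') * (2 * real k + 1) * (2 * real k' + 1) * (W3 N l k k')\<^sup>2)"

definition ricci_neg :: "nat \<Rightarrow> nat \<Rightarrow> real" where
  "ricci_neg N l = real N / (hbar N)\<^sup>2 *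
     (\<Sum>k = 1..N - 1. \<Sum>k' \<in> {k' \<in> {1..N - 1}. odd (k + k' + l)}.
        (lam k - lam k')\<^sup>2 / (lam k * lam k' * lam l)
          * (2 * real k + 1) * (2 * real k' + 1) * (W3 N l k k')\<^sup>2)"

end

theory Submission imports Defs begin

text \<open>
  Put \<open>n = N - 1\<close>. Both curvature sums run over indices with \<open>k + k' + l\<close> odd. Restricting a sum to one
  parity is half the difference of the plain and the alternating sum. The negative part therefore needs
  the sums over \<open>k\<close> of \<open>(2 * k + 1) * (W3 N k j l)\<^sup>2\<close> with weight \<open>lam k\<close> and with weight \<open>1\<close>, each with and without
  the sign \<open>(-1) ^ k\<close>. The hypotheses supply weight \<open>lam k\<close>. What has to be added is weight \<open>1\<close>: the orthogonality
  relation \<open>(\<Sum>k = 0..n. (2 * k + 1) * (W3 N k j l)\<^sup>2) = 1 / N\<close> (theorem \<open>sixj_orthogonality\<close>), and the alternating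
  sum, which \<open>sixj_alternating_sum\<close> reduces to the one with weight \<open>lam k\<close>.

  These two facts are derived from Racah's formula. For fixed \<open>l\<close>, creative telescoping yields three
  relations between the values of Racah's sum at neighbouring \<open>(k, j)\<close>. For the normalised symbol their
  coefficients are square roots that depend on \<open>k\<close>, \<open>j\<close>, \<open>k - j\<close> and \<open>k + j\<close> separately. They imply that
  the orthogonality sum is independent of \<open>j \<le> l\<close>, the difference for consecutive \<open>j\<close> being a telescoping sum
  of products of neighbouring symbols; for \<open>j = 0\<close> only one term is left. They also contain the three-term
  recurrence in \<open>k\<close>, and that makes the alternating sum with weight \<open>lam k - lam j - lam l\<close> vanish.

  Let \<open>P j\<close> be the sum with weight \<open>1\<close> over \<open>k\<close> of the right parity. Then
  \<open>P j = (1 / N + (-1) ^ (j + l + N) * W2 N j l) / 2\<close>, and the sum with weight \<open>lam k\<close> equals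
  \<open>(lam j + lam l) * P j\<close> up to an explicit multiple of \<open>lam j * lam l\<close>. Expanding the square in the negative part
  leaves the double sum with weight \<open>lam k / lam j\<close> minus the one with weight \<open>1\<close>. In this difference the
  contributions \<open>lam j * P j\<close> cancel, and \<open>lam l * P j\<close> is summed by the fourth hypothesis, which gives
  \<open>harm l - 1\<close>. In the positive part the terms \<open>j \<noteq> l\<close> are bounded by the first hypothesis and partial fractions
  (\<open>sum_resolvent_le_harm\<close>), contributing \<open>4 * harm l\<close>; the term \<open>j = l\<close> is bounded by orthogonality,
  contributing at most \<open>2 * l + 1\<close>.
\<close>

section \<open>Contiguous relations for Racah's sum\<close>

text \<open>The reciprocal factorial, continued by 0 to the negative integers. Racah's sum can then be taken
  over one fixed range for all arguments, and \<open>rfact_pred\<close> needs no side condition, so that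
  identities between summands hold at the ends of the range as well.\<close>

definition rfact :: "int \<Rightarrow> real" where
  "rfact m = (if m < 0 then 0 else 1 / fact (nat m))"

lemma rfact_neg [simp]: "m < 0 \<Longrightarrow> rfact m = 0"
  by (simp add: rfact_def)

lemma rfact_pred: "rfact (m - 1) = of_int m * rfact m"
proof (cases "m \<ge> 1")
  case True
  then have "nat m = Suc (nat (m - 1))" by simp
  then have "(fact (nat m) :: real) = of_int m * fact (nat (m - 1))"
    using True by simp
  then show ?thesis using True by (simp add: rfact_def)
qed (auto simp: rfact_def)

text \<open>The summand of Racah's formula for \<open>W3 (n + 1) k j l\<close>, with the summation variable shifted by
  \<open>n\<close> and without the square-root prefactor. The shift makes the symmetry in \<open>k, j, l\<close>
  visible.\<close>

definition racah_term :: "nat \<Rightarrow> int \<Rightarrow> int \<Rightarrow> int \<Rightarrow> nat \<Rightarrow> real" where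
  "racah_term n k j l s = (-1) ^ s * fact (n + s + 1)
     * rfact (int n + int s - k - j - l) * rfact (int s - k) * rfact (int s - j) * rfact (int s - l)
     * rfact (k + j - int s) * rfact (j + l - int s) * rfact (k + l - int s)"

text \<open>A nonzero summand has \<open>s \<le> k + j\<close>, so the range below is large enough for the symbol and for
  its neighbours, whose entries are at most \<open>n + 1\<close>.\<close>

definition racah_sum :: "nat \<Rightarrow> int \<Rightarrow> int \<Rightarrow> int \<Rightarrow> real" where
  "racah_sum n k j l = (\<Sum>s < 2 * n + 4. racah_term n k j l s)"

lemma racah_sum_swap12: "racah_sum n k j l = racah_sum n j k l"
  unfolding racah_sum_def racah_term_def by (simp add: add_ac mult_ac diff_diff_eq)

lemma racah_sum_swap23: "racah_sum n k j l = racah_sum n k l j"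
  unfolding racah_sum_def racah_term_def by (simp add: add_ac mult_ac diff_diff_eq)

lemma racah_sum_eq_0:
  assumes "k > int n \<or> j > int n \<or> l > int n \<or> k > j + l \<or> j > k + l \<or> l > k + j"
  shows "racah_sum n k j l = 0"
  unfolding racah_sum_def
proof (intro sum.neutral ballI)
  fix s
  have "int n + int s - k - j - l < 0 \<or> int s - k < 0 \<or> int s - j < 0 \<or> int s - l < 0
      \<or> k + j - int s < 0 \<or> j + l - int s < 0 \<or> k + l - int s < 0"
    using assms by linarith
  then show "racah_term n k j l s = 0"
    unfolding racah_term_def by (elim disjE) simp_all
qed

lemma sum_telescope_eq_0:
  fixes f g :: "nat \<Rightarrow> real"
  assumes "\<And>s. f s = g (Suc s) - g s" "g 0 = 0" "g M = 0"
  shows "(\<Sum>s<M. f s) = 0"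
  using assms by (simp add: sum_lessThan_telescope)

text \<open>The next three lemmas relate the value at \<open>(k, j)\<close> to two of its neighbours, \<open>l\<close> being
  fixed. Together they say that along \<open>k\<close> and \<open>j\<close> the sums span a two-dimensional space over
  the rational functions, and everything below is deduced from them. Each is proved by creative
  telescoping: the same linear relation between the summands equals \<open>g (s + 1) - g s\<close> for an
  explicit \<open>g\<close>, a polynomial times a product of reciprocal factorials, that vanishes at both ends.
  After division by the common factor \<open>b\<close> this is an identity between polynomials.\<close>

lemma racah_sum_contiguous_raise:
  assumes "k \<ge> 0" "j \<ge> 0" "k + j \<le> 2 * int n + 2"
  shows "of_int ((k + 1) * (k + 1 + l - j)) * racah_sum n (k + 1) j l
       - of_int ((j + 1) * (j + 1 + l - k)) * racah_sum n k (j + 1) l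
       - of_int ((k - j) * (k + j + l + 2)) * racah_sum n k j l = 0"
proof -
  define g where "g s = of_int (k - j) * (-1) ^ s * fact (n + s + 1)
     * rfact (int n + int s - k - j - l - 1) * rfact (int s - k - 1) * rfact (int s - j - 1)
     * rfact (int s - l - 1) * rfact (k + j + 1 - int s) * rfact (j + l + 1 - int s)
     * rfact (k + l + 1 - int s)" for s :: nat
  have "of_int ((k + 1) * (k + 1 + l - j)) * racah_term n (k + 1) j l s
       - of_int ((j + 1) * (j + 1 + l - k)) * racah_term n k (j + 1) l s
       - of_int ((k - j) * (k + j + l + 2)) * racah_term n k j l s = g (Suc s) - g s" for s
  proof -
    define b where "b = (-1) ^ s * fact (n + s + 1)
     * rfact (int n + int s - k - j - l) * rfact (int s - k) * rfact (int s - j) * rfact (int s - l)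
     * rfact (k + j + 1 - int s) * rfact (j + l + 1 - int s) * rfact (k + l + 1 - int s)"
    define m k' j' l' s' where "m = real n" and "k' = real_of_int k" and "j' = real_of_int j"
      and "l' = real_of_int l" and "s' = real s"
    note d = m_def k'_def j'_def l'_def s'_def b_def
    have e1: "rfact (k + j - int s) = (k' + j' + 1 - s') * rfact (k + j + 1 - int s)"
      using rfact_pred[of "k + j + 1 - int s"] by (simp add: d algebra_simps)
    have e2: "rfact (j + l - int s) = (j' + l' + 1 - s') * rfact (j + l + 1 - int s)"
      using rfact_pred[of "j + l + 1 - int s"] by (simp add: d algebra_simps)
    have e3: "rfact (k + l - int s) = (k' + l' + 1 - s') * rfact (k + l + 1 - int s)"
      using rfact_pred[of "k + l + 1 - int s"] by (simp add: d algebra_simps)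
    have e4: "rfact (int n + int s - k - j - l - 1)
        = (m + s' - k' - j' - l') * rfact (int n + int s - k - j - l)"
      using rfact_pred[of "int n + int s - k - j - l"] by (simp add: d)
    have e5: "rfact (int s - k - 1) = (s' - k') * rfact (int s - k)"
      using rfact_pred[of "int s - k"] by (simp add: d)
    have e6: "rfact (int s - j - 1) = (s' - j') * rfact (int s - j)"
      using rfact_pred[of "int s - j"] by (simp add: d)
    have e7: "rfact (int s - l - 1) = (s' - l') * rfact (int s - l)"
      using rfact_pred[of "int s - l"] by (simp add: d)
    have f: "(fact (n + Suc s + 1) :: real) = (m + s' + 2) * fact (n + s + 1)"
      by (simp add: d algebra_simps)
    have i: "int n + int s - (k + 1) - j - l = int n + int s - k - j - l - 1"
      "int n + int s - k - (j + 1) - l = int n + int s - k - j - l - 1"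
      "int s - (k + 1) = int s - k - 1" "int s - (j + 1) = int s - j - 1"
      "k + 1 + j - int s = k + j + 1 - int s" "k + (j + 1) - int s = k + j + 1 - int s"
      "k + 1 + l - int s = k + l + 1 - int s" "j + 1 + l - int s = j + l + 1 - int s"
      "int n + int (Suc s) - k - j - l - 1 = int n + int s - k - j - l"
      "int (Suc s) - k - 1 = int s - k" "int (Suc s) - j - 1 = int s - j"
      "int (Suc s) - l - 1 = int s - l" "k + j + 1 - int (Suc s) = k + j - int s"
      "j + l + 1 - int (Suc s) = j + l - int s" "k + l + 1 - int (Suc s) = k + l - int s"
      by simp_all
    have t: "racah_term n (k + 1) j l s = (m + s' - k' - j' - l') * (s' - k') * (j' + l' + 1 - s') * b"
      "racah_term n k (j + 1) l s = (m + s' - k' - j' - l') * (s' - j') * (k' + l' + 1 - s') * b"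
      "racah_term n k j l s = (k' + j' + 1 - s') * (j' + l' + 1 - s') * (k' + l' + 1 - s') * b"
      "g (Suc s) = - ((k' - j') * (m + s' + 2) * (k' + j' + 1 - s') * (j' + l' + 1 - s') * (k' + l' + 1 - s')) * b"
      "g s = (k' - j') * (m + s' - k' - j' - l') * (s' - k') * (s' - j') * (s' - l') * b"
      unfolding racah_term_def g_def i e1 e2 e3 e4 e5 e6 e7 f b_def by (simp_all add: k'_def j'_def mult_ac)
    have p: "((k' + 1) * (k' + 1 + l' - j')) * ((m + s' - k' - j' - l') * (s' - k') * (j' + l' + 1 - s'))
       - ((j' + 1) * (j' + 1 + l' - k')) * ((m + s' - k' - j' - l') * (s' - j') * (k' + l' + 1 - s'))
       - ((k' - j') * (k' + j' + l' + 2)) * ((k' + j' + 1 - s') * (j' + l' + 1 - s') * (k' + l' + 1 - s'))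
       = - ((k' - j') * (m + s' + 2) * (k' + j' + 1 - s') * (j' + l' + 1 - s') * (k' + l' + 1 - s'))
         - (k' - j') * (m + s' - k' - j' - l') * (s' - k') * (s' - j') * (s' - l')"
      by algebra
    have c: "of_int ((k + 1) * (k + 1 + l - j)) = (k' + 1) * (k' + 1 + l' - j')"
      "of_int ((j + 1) * (j + 1 + l - k)) = (j' + 1) * (j' + 1 + l' - k')"
      "of_int ((k - j) * (k + j + l + 2)) = (k' - j') * (k' + j' + l' + 2)"
      by (simp_all add: d)
    show ?thesis unfolding t c using arg_cong[OF p, of "\<lambda>x. x * b"] by (simp only: left_diff_distrib mult.assoc)
  qed
  then have "(\<Sum>s < 2 * n + 4. of_int ((k + 1) * (k + 1 + l - j)) * racah_term n (k + 1) j l s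
       - of_int ((j + 1) * (j + 1 + l - k)) * racah_term n k (j + 1) l s
       - of_int ((k - j) * (k + j + l + 2)) * racah_term n k j l s) = 0"
    using assms by (rule_tac g = g in sum_telescope_eq_0) (auto simp: g_def)
  then show ?thesis unfolding racah_sum_def by (simp only: sum_distrib_left sum_subtractf)
qed

lemma racah_sum_contiguous_mixed:
  assumes "j \<ge> 0" "l \<ge> 0" "k + j \<le> 2 * int n + 2"
  shows "of_int ((j + 1) * k * (k + j + 1 - l)) * racah_sum n k (j + 1) l
       + of_int (k * (k + l - j) * (k + j + 1)) * racah_sum n k j l
       + of_int ((k + j + l + 1) * ((int n + 1)\<^sup>2 - k\<^sup>2)) * racah_sum n (k - 1) j l = 0"
proof -
  \<comment> \<open>The polynomial factor of the certificate; it is the solution of the linear system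
    that comparing coefficients of powers of \<open>s\<close> gives.\<close>
  define y where "y n k j l s = - (n + 1) * s\<^sup>2 + ((2 * k + 2 * j + l + 2) * (n + 1) - k * (k + j + 1)) * s
      - (n + 1) * ((k + j + 1) * (k + j + 1 + l) + k * (j + 1)) + k * ((j + 1) * l + (k + j + 1)\<^sup>2)"
    for n k j l s :: real
  define g where "g s = y n k j l s * (-1) ^ s * fact (n + s + 1)
     * rfact (int n + int s - k - j - l) * rfact (int s - k) * rfact (int s - j - 1)
     * rfact (int s - l - 1) * rfact (k + j + 1 - int s) * rfact (j + l + 1 - int s)
     * rfact (k + l - int s)" for s :: nat
  have "of_int ((j + 1) * k * (k + j + 1 - l)) * racah_term n k (j + 1) l s
       + of_int (k * (k + l - j) * (k + j + 1)) * racah_term n k j l s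
       + of_int ((k + j + l + 1) * ((int n + 1)\<^sup>2 - k\<^sup>2)) * racah_term n (k - 1) j l s
       = g (Suc s) - g s" for s
  proof -
    define b where "b = (-1) ^ s * fact (n + s + 1)
     * rfact (int n + int s - k - j - l + 1) * rfact (int s - k + 1) * rfact (int s - j) * rfact (int s - l)
     * rfact (k + j + 1 - int s) * rfact (j + l + 1 - int s) * rfact (k + l - int s)"
    define m k' j' l' s' where "m = real n" and "k' = real_of_int k" and "j' = real_of_int j"
      and "l' = real_of_int l" and "s' = real s"
    note d = m_def k'_def j'_def l'_def s'_def b_def
    have e0: "rfact (k + j - int s - 1) = (k' + j' - s') * rfact (k + j - int s)"
      using rfact_pred[of "k + j - int s"] by (simp add: d algebra_simps)
    have e1: "rfact (k + j - int s) = (k' + j' + 1 - s') * rfact (k + j + 1 - int s)"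
      using rfact_pred[of "k + j + 1 - int s"] by (simp add: d algebra_simps)
    have e2: "rfact (j + l - int s) = (j' + l' + 1 - s') * rfact (j + l + 1 - int s)"
      using rfact_pred[of "j + l + 1 - int s"] by (simp add: d algebra_simps)
    have e3: "rfact (k + l - int s - 1) = (k' + l' - s') * rfact (k + l - int s)"
      using rfact_pred[of "k + l - int s"] by (simp add: d algebra_simps)
    have e8: "rfact (int n + int s - k - j - l - 1)
        = (m + s' - k' - j' - l') * rfact (int n + int s - k - j - l)"
      using rfact_pred[of "int n + int s - k - j - l"] by (simp add: d)
    have e4: "rfact (int n + int s - k - j - l)
        = (m + s' - k' - j' - l' + 1) * rfact (int n + int s - k - j - l + 1)"
      using rfact_pred[of "int n + int s - k - j - l + 1"] by (simp add: d)
    have e5: "rfact (int s - k) = (s' - k' + 1) * rfact (int s - k + 1)"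
      using rfact_pred[of "int s - k + 1"] by (simp add: d)
    have e6: "rfact (int s - j - 1) = (s' - j') * rfact (int s - j)"
      using rfact_pred[of "int s - j"] by (simp add: d)
    have e7: "rfact (int s - l - 1) = (s' - l') * rfact (int s - l)"
      using rfact_pred[of "int s - l"] by (simp add: d)
    have f: "(fact (n + Suc s + 1) :: real) = (m + s' + 2) * fact (n + s + 1)"
      by (simp add: d algebra_simps)
    have i: "int n + int s - (k - 1) - j - l = int n + int s - k - j - l + 1"
      "int n + int s - k - (j + 1) - l = int n + int s - k - j - l - 1"
      "int s - (k - 1) = int s - k + 1" "int s - (j + 1) = int s - j - 1"
      "k - 1 + j - int s = k + j - int s - 1" "k + (j + 1) - int s = k + j + 1 - int s"
      "k - 1 + l - int s = k + l - int s - 1" "j + 1 + l - int s = j + l + 1 - int s"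
      "int n + int (Suc s) - k - j - l = int n + int s - k - j - l + 1"
      "int (Suc s) - k = int s - k + 1" "int (Suc s) - j - 1 = int s - j"
      "int (Suc s) - l - 1 = int s - l" "k + j + 1 - int (Suc s) = k + j - int s"
      "j + l + 1 - int (Suc s) = j + l - int s" "k + l - int (Suc s) = k + l - int s - 1"
      by simp_all
    have t: "racah_term n k (j + 1) l s
        = (m + s' - k' - j' - l') * (m + s' - k' - j' - l' + 1) * (s' - k' + 1) * (s' - j') * b"
      "racah_term n k j l s
        = (m + s' - k' - j' - l' + 1) * (s' - k' + 1) * (k' + j' + 1 - s') * (j' + l' + 1 - s') * b"
      "racah_term n (k - 1) j l s
        = (k' + j' - s') * (k' + j' + 1 - s') * (j' + l' + 1 - s') * (k' + l' - s') * b"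
      "g (Suc s) = - (y m k' j' l' (s' + 1) * (m + s' + 2) * (k' + j' + 1 - s') * (j' + l' + 1 - s')
          * (k' + l' - s')) * b"
      "g s = y m k' j' l' s' * (m + s' - k' - j' - l' + 1) * (s' - k' + 1) * (s' - j') * (s' - l') * b"
      unfolding racah_term_def g_def i e0 e8 unfolding e1 e2 e3 e4 e5 e6 e7 f b_def
      by (simp_all add: m_def k'_def j'_def l'_def s'_def mult_ac add_ac)
    have p: "((j' + 1) * k' * (k' + j' + 1 - l'))
           * ((m + s' - k' - j' - l') * (m + s' - k' - j' - l' + 1) * (s' - k' + 1) * (s' - j'))
       + (k' * (k' + l' - j') * (k' + j' + 1))
           * ((m + s' - k' - j' - l' + 1) * (s' - k' + 1) * (k' + j' + 1 - s') * (j' + l' + 1 - s'))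
       + ((k' + j' + l' + 1) * ((m + 1)\<^sup>2 - k'\<^sup>2))
           * ((k' + j' - s') * (k' + j' + 1 - s') * (j' + l' + 1 - s') * (k' + l' - s'))
       = - (y m k' j' l' (s' + 1) * (m + s' + 2) * (k' + j' + 1 - s') * (j' + l' + 1 - s')
          * (k' + l' - s'))
         - y m k' j' l' s' * (m + s' - k' - j' - l' + 1) * (s' - k' + 1) * (s' - j') * (s' - l')"
      unfolding y_def by algebra
    have c: "of_int ((j + 1) * k * (k + j + 1 - l)) = (j' + 1) * k' * (k' + j' + 1 - l')"
      "of_int (k * (k + l - j) * (k + j + 1)) = k' * (k' + l' - j') * (k' + j' + 1)"
      "of_int ((k + j + l + 1) * ((int n + 1)\<^sup>2 - k\<^sup>2)) = (k' + j' + l' + 1) * ((m + 1)\<^sup>2 - k'\<^sup>2)"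
      by (simp_all add: d)
    show ?thesis unfolding t c using arg_cong[OF p, of "\<lambda>x. x * b"]
      by (simp only: left_diff_distrib distrib_right mult.assoc)
  qed
  then have "(\<Sum>s < 2 * n + 4. of_int ((j + 1) * k * (k + j + 1 - l)) * racah_term n k (j + 1) l s
       + of_int (k * (k + l - j) * (k + j + 1)) * racah_term n k j l s
       + of_int ((k + j + l + 1) * ((int n + 1)\<^sup>2 - k\<^sup>2)) * racah_term n (k - 1) j l s) = 0"
    using assms by (rule_tac g = g in sum_telescope_eq_0) (auto simp: g_def)
  then show ?thesis unfolding racah_sum_def by (simp only: sum_distrib_left sum.distrib)
qed

lemma racah_sum_contiguous_lower:
  assumes "l \<ge> 0" "k + j \<le> 2 * int n + 2"
  shows "of_int (j * ((int n + 1)\<^sup>2 - k\<^sup>2) * (j + l + 1 - k)) * racah_sum n (k - 1) j l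
       - of_int (k * ((int n + 1)\<^sup>2 - j\<^sup>2) * (k + l + 1 - j)) * racah_sum n k (j - 1) l
       - of_int (k * j * (k - j) * (k + j - l)) * racah_sum n k j l = 0"
proof -
  \<comment> \<open>Again the solution of Gosper's equation, here of degree one in \<open>s\<close>.\<close>
  define y where "y n k j s = (k - j) * ((n + 1) * s - ((n + 1) * (k + j) - k * j))"
    for n k j s :: real
  define g where "g s = y n k j s * (-1) ^ s * fact (n + s + 1)
     * rfact (int n + int s - k - j - l) * rfact (int s - k) * rfact (int s - j)
     * rfact (int s - l - 1) * rfact (k + j - int s) * rfact (j + l - int s)
     * rfact (k + l - int s)" for s :: nat
  have "of_int (j * ((int n + 1)\<^sup>2 - k\<^sup>2) * (j + l + 1 - k)) * racah_term n (k - 1) j l s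
       - of_int (k * ((int n + 1)\<^sup>2 - j\<^sup>2) * (k + l + 1 - j)) * racah_term n k (j - 1) l s
       - of_int (k * j * (k - j) * (k + j - l)) * racah_term n k j l s = g (Suc s) - g s" for s
  proof -
    define b where "b = (-1) ^ s * fact (n + s + 1)
     * rfact (int n + int s - k - j - l + 1) * rfact (int s - k + 1) * rfact (int s - j + 1)
     * rfact (int s - l) * rfact (k + j - int s) * rfact (j + l - int s) * rfact (k + l - int s)"
    define m k' j' l' s' where "m = real n" and "k' = real_of_int k" and "j' = real_of_int j"
      and "l' = real_of_int l" and "s' = real s"
    note d = m_def k'_def j'_def l'_def s'_def b_def
    have e1: "rfact (k + j - int s - 1) = (k' + j' - s') * rfact (k + j - int s)"
      using rfact_pred[of "k + j - int s"] by (simp add: d algebra_simps)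
    have e2: "rfact (j + l - int s - 1) = (j' + l' - s') * rfact (j + l - int s)"
      using rfact_pred[of "j + l - int s"] by (simp add: d algebra_simps)
    have e3: "rfact (k + l - int s - 1) = (k' + l' - s') * rfact (k + l - int s)"
      using rfact_pred[of "k + l - int s"] by (simp add: d algebra_simps)
    have e4: "rfact (int n + int s - k - j - l)
        = (m + s' - k' - j' - l' + 1) * rfact (int n + int s - k - j - l + 1)"
      using rfact_pred[of "int n + int s - k - j - l + 1"] by (simp add: d)
    have e5: "rfact (int s - k) = (s' - k' + 1) * rfact (int s - k + 1)"
      using rfact_pred[of "int s - k + 1"] by (simp add: d)
    have e6: "rfact (int s - j) = (s' - j' + 1) * rfact (int s - j + 1)"
      using rfact_pred[of "int s - j + 1"] by (simp add: d)
    have e7: "rfact (int s - l - 1) = (s' - l') * rfact (int s - l)"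
      using rfact_pred[of "int s - l"] by (simp add: d)
    have f: "(fact (n + Suc s + 1) :: real) = (m + s' + 2) * fact (n + s + 1)"
      by (simp add: d algebra_simps)
    have i: "int n + int s - (k - 1) - j - l = int n + int s - k - j - l + 1"
      "int n + int s - k - (j - 1) - l = int n + int s - k - j - l + 1"
      "int s - (k - 1) = int s - k + 1" "int s - (j - 1) = int s - j + 1"
      "k - 1 + j - int s = k + j - int s - 1" "k + (j - 1) - int s = k + j - int s - 1"
      "k - 1 + l - int s = k + l - int s - 1" "j - 1 + l - int s = j + l - int s - 1"
      "int n + int (Suc s) - k - j - l = int n + int s - k - j - l + 1"
      "int (Suc s) - k = int s - k + 1" "int (Suc s) - j = int s - j + 1"
      "int (Suc s) - l - 1 = int s - l" "k + j - int (Suc s) = k + j - int s - 1"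
      "j + l - int (Suc s) = j + l - int s - 1" "k + l - int (Suc s) = k + l - int s - 1"
      by simp_all
    have t: "racah_term n (k - 1) j l s = (k' + j' - s') * (k' + l' - s') * (s' - j' + 1) * b"
      "racah_term n k (j - 1) l s = (k' + j' - s') * (j' + l' - s') * (s' - k' + 1) * b"
      "racah_term n k j l s = (m + s' - k' - j' - l' + 1) * (s' - k' + 1) * (s' - j' + 1) * b"
      "g (Suc s) = - (y m k' j' (s' + 1) * (m + s' + 2) * (k' + j' - s') * (j' + l' - s')
          * (k' + l' - s')) * b"
      "g s = y m k' j' s' * (m + s' - k' - j' - l' + 1) * (s' - k' + 1) * (s' - j' + 1) * (s' - l') * b"
      unfolding racah_term_def g_def i e1 e2 e3 e4 e5 e6 e7 f b_def
      by (simp_all add: m_def k'_def j'_def l'_def s'_def mult_ac add_ac)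
    have p: "(j' * ((m + 1)\<^sup>2 - k'\<^sup>2) * (j' + l' + 1 - k'))
           * ((k' + j' - s') * (k' + l' - s') * (s' - j' + 1))
       - (k' * ((m + 1)\<^sup>2 - j'\<^sup>2) * (k' + l' + 1 - j'))
           * ((k' + j' - s') * (j' + l' - s') * (s' - k' + 1))
       - (k' * j' * (k' - j') * (k' + j' - l'))
           * ((m + s' - k' - j' - l' + 1) * (s' - k' + 1) * (s' - j' + 1))
       = - (y m k' j' (s' + 1) * (m + s' + 2) * (k' + j' - s') * (j' + l' - s') * (k' + l' - s'))
         - y m k' j' s' * (m + s' - k' - j' - l' + 1) * (s' - k' + 1) * (s' - j' + 1) * (s' - l')"
      unfolding y_def by algebra
    have c: "of_int (j * ((int n + 1)\<^sup>2 - k\<^sup>2) * (j + l + 1 - k))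
          = j' * ((m + 1)\<^sup>2 - k'\<^sup>2) * (j' + l' + 1 - k')"
      "of_int (k * ((int n + 1)\<^sup>2 - j\<^sup>2) * (k + l + 1 - j)) = k' * ((m + 1)\<^sup>2 - j'\<^sup>2) * (k' + l' + 1 - j')"
      "of_int (k * j * (k - j) * (k + j - l)) = k' * j' * (k' - j') * (k' + j' - l')"
      by (simp_all add: d)
    show ?thesis unfolding t c using arg_cong[OF p, of "\<lambda>x. x * b"]
      by (simp only: left_diff_distrib mult.assoc)
  qed
  then have "(\<Sum>s < 2 * n + 4.
         of_int (j * ((int n + 1)\<^sup>2 - k\<^sup>2) * (j + l + 1 - k)) * racah_term n (k - 1) j l s
       - of_int (k * ((int n + 1)\<^sup>2 - j\<^sup>2) * (k + l + 1 - j)) * racah_term n k (j - 1) l s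
       - of_int (k * j * (k - j) * (k + j - l)) * racah_term n k j l s) = 0"
    using assms by (rule_tac g = g in sum_telescope_eq_0) (auto simp: g_def)
  then show ?thesis unfolding racah_sum_def by (simp only: sum_distrib_left sum_subtractf)
qed

section \<open>The normalised symbol and its first-order relations\<close>

text \<open>The square of the triangle coefficient of \<open>(k, n / 2, n / 2)\<close>.\<close>

definition edge_weight :: "nat \<Rightarrow> int \<Rightarrow> real" where
  "edge_weight n k = (fact (nat k))\<^sup>2 * fact (nat (int n - k)) / fact (nat (int n + k + 1))"

definition face_weight :: "int \<Rightarrow> int \<Rightarrow> int \<Rightarrow> int \<Rightarrow> real" where
  "face_weight a b c d = fact (nat a) * fact (nat b) * fact (nat c) / fact (nat d)"

definition sixj_weight :: "nat \<Rightarrow> int \<Rightarrow> int \<Rightarrow> int \<Rightarrow> real" where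
  "sixj_weight n k j l = edge_weight n k * edge_weight n j * edge_weight n l
     * face_weight (k + j - l) (k + l - j) (j + l - k) (k + j + l + 1)"

text \<open>Up to the sign \<open>(-1) ^ n\<close> this is \<open>W3 (n + 1) k j l\<close>. Integer arguments admit the neighbour
  \<open>k - 1\<close> of \<open>k = 0\<close>; the symbol vanishes there, as it does wherever a triangle condition
  fails.\<close>

definition sixj :: "nat \<Rightarrow> int \<Rightarrow> int \<Rightarrow> int \<Rightarrow> real" where
  "sixj n k j l = sqrt (sixj_weight n k j l) * racah_sum n k j l"

definition sixj_admissible :: "nat \<Rightarrow> int \<Rightarrow> int \<Rightarrow> int \<Rightarrow> bool" where
  "sixj_admissible n k j l \<longleftrightarrow> k \<le> int n \<and> j \<le> int n \<and> l \<le> int n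
     \<and> k \<le> j + l \<and> j \<le> k + l \<and> l \<le> k + j"

lemma racah_sum_inadmissible: "\<not> sixj_admissible n k j l \<Longrightarrow> racah_sum n k j l = 0"
  unfolding sixj_admissible_def by (rule racah_sum_eq_0) linarith

lemma sixj_inadmissible: "\<not> sixj_admissible n k j l \<Longrightarrow> sixj n k j l = 0"
  by (simp add: sixj_def racah_sum_inadmissible)

lemma sixj_swap12: "sixj n k j l = sixj n j k l"
  unfolding sixj_def sixj_weight_def face_weight_def racah_sum_swap12[of n k j l]
  by (simp add: add_ac mult_ac)

lemma sixj_swap23: "sixj n k j l = sixj n k l j"
  unfolding sixj_def sixj_weight_def face_weight_def racah_sum_swap23[of n k j l]
  by (simp add: add_ac mult_ac)

lemma edge_weight_nonneg: "edge_weight n k \<ge> 0"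
  by (simp add: edge_weight_def)

lemma face_weight_nonneg: "face_weight a b c d \<ge> 0"
  by (simp add: face_weight_def)

lemma fact_nat_plus_1: "m \<ge> 0 \<Longrightarrow> (fact (nat (m + 1)) :: real) = (of_int m + 1) * fact (nat m)"
  by (simp add: nat_add_distrib algebra_simps)

text \<open>Stated with a spare factor \<open>m\<close> so that it also covers \<open>m = 0\<close>, which occurs on the boundary
  of the triangle region.\<close>

lemma fact_nat_times_self:
  assumes "m \<ge> 0"
  shows "of_int m * (fact (nat m) :: real) = (of_int m)\<^sup>2 * fact (nat (m - 1))"
proof (cases "m = 0")
  case False
  then show ?thesis using fact_nat_plus_1[of "m - 1"] assms by (simp add: power2_eq_square)
qed simp

lemma edge_weight_step:
  assumes "0 < k" "k \<le> int n"
  shows "((real n + 1)\<^sup>2 - (of_int k)\<^sup>2) * edge_weight n k = (of_int k)\<^sup>2 * edge_weight n (k - 1)"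
proof -
  have e: "(fact (nat k) :: real) = of_int k * fact (nat (k - 1))"
    "(fact (nat (int n - k + 1)) :: real) = (real n - of_int k + 1) * fact (nat (int n - k))"
    "(fact (nat (int n + k + 1)) :: real) = (real n + of_int k + 1) * fact (nat (int n + k))"
    using fact_nat_plus_1[of "k - 1"] fact_nat_plus_1[of "int n - k"] fact_nat_plus_1[of "int n + k"] assms
    by simp_all
  have i: "int n - (k - 1) = int n - k + 1" "int n + (k - 1) + 1 = int n + k" by simp_all
  have "real n + of_int k + 1 \<noteq> 0" using assms by linarith
  then show ?thesis unfolding edge_weight_def i e
    by (simp add: divide_simps) (simp add: algebra_simps power2_eq_square)
qed

text \<open>The three coefficients of the contiguous relations once the symbol is normalised. With
  \<open>d = k - j\<close> and \<open>m = k + j\<close>, the last two satisfy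
  \<open>(ladder_diff l d)\<^sup>2 + (ladder_sum l m)\<^sup>2 = (2 * k + 1) * (2 * j + 2)\<close> wherever both radicands are
  nonnegative; this is what makes the orthogonality sum telescope.\<close>

definition ladder_edge :: "nat \<Rightarrow> int \<Rightarrow> real" where
  "ladder_edge n k = sqrt ((real n + 1)\<^sup>2 - (of_int k)\<^sup>2)"

definition ladder_diff :: "int \<Rightarrow> int \<Rightarrow> real" where
  "ladder_diff l d = sqrt (of_int ((l + d) * (l + 1 - d)))"

definition ladder_sum :: "int \<Rightarrow> int \<Rightarrow> real" where
  "ladder_sum l m = sqrt (of_int ((m + 2 + l) * (m + 1 - l)))"

lemma ladder_diff_reflect: "ladder_diff l (1 - d) = ladder_diff l d"
  unfolding ladder_diff_def by (simp add: algebra_simps)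

text \<open>Turns an identity between weights into one between normalised symbols. The hypothesis is only
  required for admissible entries, because otherwise both sides vanish; where the entries
  are admissible, no factorial in \<open>sixj_weight\<close> has a negative argument.\<close>

lemma sqrt_times_sixj:
  assumes "sixj_admissible n k j l \<Longrightarrow> c * sixj_weight n k j l = r\<^sup>2 * x \<and> r \<ge> 0"
  shows "sqrt c * sixj n k j l = r * sqrt x * racah_sum n k j l"
proof (cases "sixj_admissible n k j l")
  case True
  then have "sqrt (c * sixj_weight n k j l) = r * sqrt x"
    using assms by (simp add: real_sqrt_mult)
  then show ?thesis by (simp add: sixj_def real_sqrt_mult)
qed (simp add: sixj_inadmissible racah_sum_inadmissible)

text \<open>Normalisation multiplies the three terms of \<open>racah_sum_contiguous_raise\<close> by square roots of
  different weights. In each term these combine with the ladder coefficients to the same square root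
  \<open>sqrt (x k j)\<close>, so the relation survives with symmetric coefficients.\<close>

lemma sixj_contiguous_raise:
  assumes k: "0 \<le> k" and j: "0 \<le> j" and l: "0 \<le> l" and le: "k \<le> int n" "j \<le> int n"
  shows "ladder_edge n (k + 1) * ladder_diff l (k - j + 1) * sixj n (k + 1) j l
       - ladder_edge n (j + 1) * ladder_diff l (k - j) * sixj n k (j + 1) l
       = of_int (k - j) * ladder_sum l (k + j) * sixj n k j l"
proof -
  define x where "x k j = edge_weight n k * edge_weight n j * edge_weight n l
      * face_weight (k + j + 1 - l) (k + l - j) (j + l - k) (k + j + l + 2)" for k j
  have raise: "ladder_edge n (k + 1) * ladder_diff l (k - j + 1) * sixj n (k + 1) j l
      = of_int ((k + 1) * (k + 1 + l - j)) * sqrt (x k j) * racah_sum n (k + 1) j l"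
    if "0 \<le> k" for k j
    unfolding ladder_edge_def ladder_diff_def real_sqrt_mult[symmetric]
  proof (rule sqrt_times_sixj)
    assume adm: "sixj_admissible n (k + 1) j l"
    note a = adm[unfolded sixj_admissible_def]
    have e: "((real n + 1)\<^sup>2 - (of_int (k + 1))\<^sup>2) * edge_weight n (k + 1) = (of_int (k + 1))\<^sup>2 * edge_weight n k"
      using edge_weight_step[of "k + 1" n] that a by simp
    have f1: "of_int (k + 1 + l - j) * fact (nat (k + 1 + l - j))
        = (of_int (k + 1 + l - j))\<^sup>2 * (fact (nat (k + l - j)) :: real)"
      using fact_nat_times_self[of "k + 1 + l - j"] a by (simp add: algebra_simps)
    have f2: "fact (nat (j + l - k)) = of_int (j + l - k) * (fact (nat (j + l - (k + 1))) :: real)"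
      using fact_nat_plus_1[of "j + l - k - 1"] a by (simp add: algebra_simps)
    have i: "k + 1 + j - l = k + j + 1 - l" "k + 1 + j + l + 1 = k + j + l + 2"
      "(l + (k - j + 1)) * (l + 1 - (k - j + 1)) = (k + 1 + l - j) * (j + l - k)"
      by (simp_all add: algebra_simps)
    have "((real n + 1)\<^sup>2 - (of_int (k + 1))\<^sup>2) * of_int ((l + (k - j + 1)) * (l + 1 - (k - j + 1)))
          * sixj_weight n (k + 1) j l
        = (((real n + 1)\<^sup>2 - (of_int (k + 1))\<^sup>2) * edge_weight n (k + 1)) * edge_weight n j * edge_weight n l
          * ((of_int (k + 1 + l - j) * fact (nat (k + 1 + l - j)))
            * (of_int (j + l - k) * fact (nat (j + l - (k + 1)))) * fact (nat (k + j + 1 - l))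
            / fact (nat (k + j + l + 2)))"
      unfolding sixj_weight_def face_weight_def i of_int_mult by simp
    also have "\<dots> = (of_int ((k + 1) * (k + 1 + l - j)))\<^sup>2 * x k j"
      unfolding e f1 f2[symmetric] x_def face_weight_def of_int_mult power_mult_distrib by simp
    finally show "((real n + 1)\<^sup>2 - (of_int (k + 1))\<^sup>2) * of_int ((l + (k - j + 1)) * (l + 1 - (k - j + 1)))
          * sixj_weight n (k + 1) j l = (of_int ((k + 1) * (k + 1 + l - j)))\<^sup>2 * x k j
        \<and> of_int ((k + 1) * (k + 1 + l - j)) \<ge> (0 :: real)"
      using that a by (simp del: of_int_mult of_int_add of_int_diff)
  qed
  have x_swap: "x k j = x j k" unfolding x_def face_weight_def by (simp add: add_ac mult_ac)
  have d_swap: "ladder_diff l (k - j) = ladder_diff l (j - k + 1)"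
    using ladder_diff_reflect[of l "k - j"] by (simp add: algebra_simps)
  have mid: "ladder_sum l (k + j) * sixj n k j l
      = of_int (k + j + l + 2) * sqrt (x k j) * racah_sum n k j l"
    unfolding ladder_sum_def
  proof (rule sqrt_times_sixj)
    assume adm: "sixj_admissible n k j l"
    note a = adm[unfolded sixj_admissible_def]
    have f1: "of_int (k + j + 1 - l) * fact (nat (k + j - l)) = (fact (nat (k + j + 1 - l)) :: real)"
      using fact_nat_plus_1[of "k + j - l"] a by (simp add: algebra_simps)
    have f2: "fact (nat (k + j + l + 2)) = of_int (k + j + l + 2) * (fact (nat (k + j + l + 1)) :: real)"
      using fact_nat_plus_1[of "k + j + l + 1"] k j l by (simp add: algebra_simps)
    have "of_int ((k + j + 2 + l) * (k + j + 1 - l)) * sixj_weight n k j l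
        = of_int (k + j + l + 2) * edge_weight n k * edge_weight n j * edge_weight n l
          * ((of_int (k + j + 1 - l) * fact (nat (k + j - l))) * fact (nat (k + l - j)) * fact (nat (j + l - k))
             / fact (nat (k + j + l + 1)))"
      unfolding sixj_weight_def face_weight_def of_int_mult by (simp add: add_ac)
    also have "\<dots> = (of_int (k + j + l + 2))\<^sup>2 * x k j"
    proof -
      have "real_of_int (k + j + l + 2) \<noteq> 0" using k j l by linarith
      then show ?thesis unfolding f1 x_def face_weight_def f2 power2_eq_square
        by (simp del: of_int_mult of_int_add of_int_diff add: divide_simps)
    qed
    finally show "of_int ((k + j + 2 + l) * (k + j + 1 - l)) * sixj_weight n k j l
        = (of_int (k + j + l + 2))\<^sup>2 * x k j \<and> of_int (k + j + l + 2) \<ge> (0 :: real)"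
      using k j l by simp
  qed
  have "sqrt (x k j) * (of_int ((k + 1) * (k + 1 + l - j)) * racah_sum n (k + 1) j l
       - of_int ((j + 1) * (j + 1 + l - k)) * racah_sum n k (j + 1) l
       - of_int ((k - j) * (k + j + l + 2)) * racah_sum n k j l) = 0"
    using racah_sum_contiguous_raise[of k j n l] k j le by simp
  then show ?thesis
    using raise[OF k, of j] raise[OF j, of k] mid
    unfolding x_swap[symmetric] d_swap[symmetric] sixj_swap12[of n "j + 1" k] racah_sum_swap12[of n "j + 1" k]
    by (simp only: of_int_mult right_diff_distrib mult_ac)
qed

text \<open>As in \<open>sixj_contiguous_raise\<close>, a common square root \<open>sqrt x\<close> is factored out. The relation for
  the sums carries a spare factor \<open>k\<close>; for \<open>k = 0\<close> the claim is checked directly, each term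
  having a vanishing factor.\<close>

lemma sixj_contiguous_mixed:
  assumes k: "0 \<le> k" and j: "0 \<le> j" and l: "0 \<le> l" and le: "k \<le> int n" "j \<le> int n"
  shows "ladder_sum l (k + j) * ladder_edge n (j + 1) * sixj n k (j + 1) l
       + ladder_sum l (k + j - 1) * ladder_edge n k * sixj n (k - 1) j l
       + of_int (k + j + 1) * ladder_diff l (k - j) * sixj n k j l = 0"
proof (cases "k = 0")
  case True
  have "ladder_sum l j * sixj n 0 (j + 1) l = 0"
  proof (cases "j + 1 = l")
    case False
    then show ?thesis
      using sixj_inadmissible[of n 0 "j + 1" l] by (auto simp: sixj_admissible_def)
  qed (auto simp: ladder_sum_def)
  moreover have "ladder_diff l (- j) * sixj n 0 j l = 0"
  proof (cases "j = l")
    case False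
    then show ?thesis
      using sixj_inadmissible[of n 0 j l] by (auto simp: sixj_admissible_def)
  qed (auto simp: ladder_diff_def)
  moreover have "sixj n (- 1) j l = 0"
    using sixj_inadmissible[of n "- 1" j l] by (auto simp: sixj_admissible_def)
  ultimately show ?thesis using True by auto
next
  case False
  then have k1: "k \<ge> 1" using k by simp
  define x where "x = edge_weight n k * edge_weight n j * edge_weight n l
      * face_weight (k + j - l) (k + l - j - 1) (j + l + 1 - k) (k + j + l + 1)"
  define q where "q = ((real n + 1)\<^sup>2 - (of_int k)\<^sup>2) / real_of_int k"
  have q: "q \<ge> 0"
  proof -
    have "(real_of_int k)\<^sup>2 \<le> (real n + 1)\<^sup>2" using k le by (intro power_mono) linarith+
    then show ?thesis using k by (simp add: q_def)
  qed
  have mid: "ladder_diff l (k - j) * sixj n k j l = of_int (k + l - j) * sqrt x * racah_sum n k j l"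
    unfolding ladder_diff_def
  proof (rule sqrt_times_sixj)
    assume adm: "sixj_admissible n k j l"
    note a = adm[unfolded sixj_admissible_def]
    have f1: "of_int (k + l - j) * (fact (nat (k + l - j)) :: real)
        = (of_int (k + l - j))\<^sup>2 * fact (nat (k + l - j - 1))"
      using fact_nat_times_self[of "k + l - j"] a by simp
    have f2: "fact (nat (j + l + 1 - k)) = of_int (j + l + 1 - k) * (fact (nat (j + l - k)) :: real)"
      using fact_nat_plus_1[of "j + l - k"] a by (simp add: algebra_simps)
    have i: "(l + (k - j)) * (l + 1 - (k - j)) = (k + l - j) * (j + l + 1 - k)"
      by (simp add: algebra_simps)
    have "of_int ((l + (k - j)) * (l + 1 - (k - j))) * sixj_weight n k j l
        = edge_weight n k * edge_weight n j * edge_weight n l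
          * ((of_int (k + l - j) * fact (nat (k + l - j))) * (of_int (j + l + 1 - k) * fact (nat (j + l - k)))
             * fact (nat (k + j - l)) / fact (nat (k + j + l + 1)))"
      unfolding sixj_weight_def face_weight_def i of_int_mult by simp
    also have "\<dots> = (of_int (k + l - j))\<^sup>2 * x"
      unfolding f1 f2[symmetric] x_def face_weight_def by simp
    finally show "of_int ((l + (k - j)) * (l + 1 - (k - j))) * sixj_weight n k j l
        = (of_int (k + l - j))\<^sup>2 * x \<and> of_int (k + l - j) \<ge> (0 :: real)"
      using a by simp
  qed
  have raise: "ladder_sum l (k + j) * ladder_edge n (j + 1) * sixj n k (j + 1) l
      = of_int ((j + 1) * (k + j + 1 - l)) * sqrt x * racah_sum n k (j + 1) l"
    unfolding ladder_edge_def ladder_sum_def real_sqrt_mult[symmetric]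
  proof (rule sqrt_times_sixj)
    assume adm: "sixj_admissible n k (j + 1) l"
    note a = adm[unfolded sixj_admissible_def]
    have e: "((real n + 1)\<^sup>2 - (of_int (j + 1))\<^sup>2) * edge_weight n (j + 1) = (of_int (j + 1))\<^sup>2 * edge_weight n j"
      using edge_weight_step[of "j + 1" n] j a by simp
    have f1: "of_int (k + j + 1 - l) * fact (nat (k + j + 1 - l))
        = (of_int (k + j + 1 - l))\<^sup>2 * (fact (nat (k + j - l)) :: real)"
      using fact_nat_times_self[of "k + j + 1 - l"] a by (simp add: algebra_simps)
    have f2: "fact (nat (k + j + l + 2)) = of_int (k + j + l + 2) * (fact (nat (k + j + l + 1)) :: real)"
      using fact_nat_plus_1[of "k + j + l + 1"] k j l by (simp add: algebra_simps)
    have i: "k + (j + 1) - l = k + j + 1 - l" "k + l - (j + 1) = k + l - j - 1"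
      "j + 1 + l - k = j + l + 1 - k" "k + (j + 1) + l + 1 = k + j + l + 2"
      "k + j + 2 + l = k + j + l + 2" by simp_all
    have "of_int ((k + j + 2 + l) * (k + j + 1 - l)) * ((real n + 1)\<^sup>2 - (of_int (j + 1))\<^sup>2)
          * sixj_weight n k (j + 1) l
        = of_int (k + j + l + 2) * edge_weight n k
          * (((real n + 1)\<^sup>2 - (of_int (j + 1))\<^sup>2) * edge_weight n (j + 1)) * edge_weight n l
          * ((of_int (k + j + 1 - l) * fact (nat (k + j + 1 - l))) * fact (nat (k + l - j - 1))
             * fact (nat (j + l + 1 - k)) / fact (nat (k + j + l + 2)))"
      unfolding sixj_weight_def face_weight_def i of_int_mult by simp
    also have "\<dots> = (of_int ((j + 1) * (k + j + 1 - l)))\<^sup>2 * x"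
    proof -
      have "real_of_int (k + j + l + 2) \<noteq> 0" using k j l by linarith
      then show ?thesis
        unfolding e f1 f2 x_def face_weight_def of_int_mult[of "j + 1"] power_mult_distrib
        by (simp del: of_int_mult of_int_add of_int_diff add: divide_simps)
    qed
    finally show "of_int ((k + j + 2 + l) * (k + j + 1 - l)) * ((real n + 1)\<^sup>2 - (of_int (j + 1))\<^sup>2)
          * sixj_weight n k (j + 1) l = (of_int ((j + 1) * (k + j + 1 - l)))\<^sup>2 * x
        \<and> of_int ((j + 1) * (k + j + 1 - l)) \<ge> (0 :: real)"
      using a j by (simp del: of_int_mult of_int_add of_int_diff)
  qed
  have lower: "ladder_sum l (k + j - 1) * ladder_edge n k * sixj n (k - 1) j l
      = (of_int (k + j + l + 1) * q) * sqrt x * racah_sum n (k - 1) j l"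
    unfolding ladder_edge_def ladder_sum_def real_sqrt_mult[symmetric]
  proof (rule sqrt_times_sixj)
    assume adm: "sixj_admissible n (k - 1) j l"
    note a = adm[unfolded sixj_admissible_def]
    have e: "((real n + 1)\<^sup>2 - (of_int k)\<^sup>2) * edge_weight n (k - 1) = q\<^sup>2 * edge_weight n k"
      using edge_weight_step[of k n] k1 le unfolding q_def
      by (simp add: power2_eq_square divide_simps)
    have f1: "fact (nat (k + j - l)) = of_int (k + j - l) * (fact (nat (k + j - l - 1)) :: real)"
      using fact_nat_plus_1[of "k + j - l - 1"] a by simp
    have f2: "fact (nat (k + j + l + 1)) = of_int (k + j + l + 1) * (fact (nat (k + j + l)) :: real)"
      using fact_nat_plus_1[of "k + j + l"] k j l by simp
    have i: "k - 1 + j - l = k + j - l - 1" "k - 1 + l - j = k + l - j - 1"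
      "j + l - (k - 1) = j + l + 1 - k" "k - 1 + j + l + 1 = k + j + l"
      "(k + j - 1 + 2 + l) * (k + j - 1 + 1 - l) = (k + j + l + 1) * (k + j - l)"
      by (simp_all add: algebra_simps)
    have "of_int ((k + j - 1 + 2 + l) * (k + j - 1 + 1 - l)) * ((real n + 1)\<^sup>2 - (of_int k)\<^sup>2)
          * sixj_weight n (k - 1) j l
        = of_int (k + j + l + 1) * (((real n + 1)\<^sup>2 - (of_int k)\<^sup>2) * edge_weight n (k - 1))
          * edge_weight n j * edge_weight n l
          * ((of_int (k + j - l) * fact (nat (k + j - l - 1))) * fact (nat (k + l - j - 1))
             * fact (nat (j + l + 1 - k)) / fact (nat (k + j + l)))"
      unfolding sixj_weight_def face_weight_def i of_int_mult by simp
    also have "\<dots> = (of_int (k + j + l + 1) * q)\<^sup>2 * x"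
    proof -
      have "real_of_int (k + j + l + 1) \<noteq> 0" using k j l by linarith
      then show ?thesis
        unfolding e unfolding f1[symmetric] x_def face_weight_def f2 power_mult_distrib power2_eq_square
        by (simp del: of_int_mult of_int_add of_int_diff add: divide_simps)
    qed
    finally show "of_int ((k + j - 1 + 2 + l) * (k + j - 1 + 1 - l)) * ((real n + 1)\<^sup>2 - (of_int k)\<^sup>2)
          * sixj_weight n (k - 1) j l = (of_int (k + j + l + 1) * q)\<^sup>2 * x
        \<and> of_int (k + j + l + 1) * q \<ge> 0"
      using k j l q by simp
  qed
  have kq: "of_int k * q = (real n + 1)\<^sup>2 - (of_int k)\<^sup>2" using k1 by (simp add: q_def)
  have "of_int ((j + 1) * k * (k + j + 1 - l)) * racah_sum n k (j + 1) l
       + of_int (k * (k + l - j) * (k + j + 1)) * racah_sum n k j l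
       + of_int (k + j + l + 1) * (of_int k * q) * racah_sum n (k - 1) j l = 0"
    using racah_sum_contiguous_mixed[of j l k n] k1 j l le unfolding kq by simp
  then have "of_int k * (of_int ((j + 1) * (k + j + 1 - l)) * racah_sum n k (j + 1) l
       + of_int ((k + l - j) * (k + j + 1)) * racah_sum n k j l
       + of_int (k + j + l + 1) * q * racah_sum n (k - 1) j l) = 0"
    by (simp add: algebra_simps)
  then have "of_int ((j + 1) * (k + j + 1 - l)) * racah_sum n k (j + 1) l
       + of_int ((k + l - j) * (k + j + 1)) * racah_sum n k j l
       + of_int (k + j + l + 1) * q * racah_sum n (k - 1) j l = 0"
    using k1 by simp
  then have "sqrt x * (of_int ((j + 1) * (k + j + 1 - l)) * racah_sum n k (j + 1) l
       + of_int ((k + l - j) * (k + j + 1)) * racah_sum n k j l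
       + of_int (k + j + l + 1) * q * racah_sum n (k - 1) j l) = 0" by simp
  moreover have "of_int (k + j + 1) * ladder_diff l (k - j) * sixj n k j l
      = of_int (k + j + 1) * (of_int (k + l - j) * sqrt x * racah_sum n k j l)"
    unfolding mid[symmetric] by simp
  ultimately show ?thesis unfolding raise lower
    by (simp add: algebra_simps)
qed

text \<open>This is \<open>sixj_contiguous_raise\<close> under the reflection \<open>k \<mapsto> - 1 - k\<close>, \<open>j \<mapsto> - 1 - j\<close> of the
  angular momenta.\<close>

lemma sixj_contiguous_lower:
  assumes k: "0 \<le> k" and j: "1 \<le> j" and l: "0 \<le> l" and le: "k \<le> int n" "j \<le> int n"
  shows "ladder_edge n k * ladder_diff l (k - j) * sixj n (k - 1) j l
       - ladder_edge n j * ladder_diff l (k - j + 1) * sixj n k (j - 1) l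
       = of_int (k - j) * ladder_sum l (k + j - 1) * sixj n k j l"
proof (cases "k = 0")
  case True
  have "ladder_sum l (j - 1) * sixj n 0 j l = 0"
  proof (cases "j = l")
    case False
    then show ?thesis
      using sixj_inadmissible[of n 0 j l] by (auto simp: sixj_admissible_def)
  qed (auto simp: ladder_sum_def)
  moreover have "ladder_diff l (1 - j) * sixj n 0 (j - 1) l = 0"
  proof (cases "j - 1 = l")
    case False
    then show ?thesis
      using sixj_inadmissible[of n 0 "j - 1" l] by (auto simp: sixj_admissible_def)
  qed (auto simp: ladder_diff_def)
  moreover have "sixj n (- 1) j l = 0"
    using sixj_inadmissible[of n "- 1" j l] by (auto simp: sixj_admissible_def)
  ultimately show ?thesis using True by auto
next
  case False
  then have k1: "k \<ge> 1" using k by simp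
  define x where "x k j = edge_weight n k * edge_weight n j * edge_weight n l
      * face_weight (k + j - l - 1) (k + l - j) (j + l - k) (k + j + l)" for k j
  define q where "q k = ((real n + 1)\<^sup>2 - (of_int k)\<^sup>2) / real_of_int k" for k
  have lower: "ladder_edge n k * ladder_diff l (k - j) * sixj n (k - 1) j l
      = (q k * of_int (j + l + 1 - k)) * sqrt (x k j) * racah_sum n (k - 1) j l"
    if k: "1 \<le> k" "k \<le> int n" for k j
    unfolding ladder_edge_def ladder_diff_def real_sqrt_mult[symmetric]
  proof (rule sqrt_times_sixj)
    assume adm: "sixj_admissible n (k - 1) j l"
    note a = adm[unfolded sixj_admissible_def]
    have q: "q k \<ge> 0"
    proof -
      have "(real_of_int k)\<^sup>2 \<le> (real n + 1)\<^sup>2" using k by (intro power_mono) linarith+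
      then show ?thesis using k by (simp add: q_def)
    qed
    have e: "((real n + 1)\<^sup>2 - (of_int k)\<^sup>2) * edge_weight n (k - 1) = (q k)\<^sup>2 * edge_weight n k"
      using edge_weight_step[of k n] k unfolding q_def
      by (simp add: power2_eq_square divide_simps)
    have f1: "fact (nat (k + l - j)) = of_int (k + l - j) * (fact (nat (k + l - j - 1)) :: real)"
      using fact_nat_plus_1[of "k + l - j - 1"] a by simp
    have f2: "of_int (j + l + 1 - k) * fact (nat (j + l + 1 - k))
        = (of_int (j + l + 1 - k))\<^sup>2 * (fact (nat (j + l - k)) :: real)"
      using fact_nat_times_self[of "j + l + 1 - k"] a by (simp add: algebra_simps)
    have i: "k - 1 + j - l = k + j - l - 1" "k - 1 + l - j = k + l - j - 1"
      "j + l - (k - 1) = j + l + 1 - k" "k - 1 + j + l + 1 = k + j + l"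
      "(l + (k - j)) * (l + 1 - (k - j)) = (k + l - j) * (j + l + 1 - k)"
      by (simp_all add: algebra_simps)
    have "((real n + 1)\<^sup>2 - (of_int k)\<^sup>2) * of_int ((l + (k - j)) * (l + 1 - (k - j)))
          * sixj_weight n (k - 1) j l
        = (((real n + 1)\<^sup>2 - (of_int k)\<^sup>2) * edge_weight n (k - 1))
          * edge_weight n j * edge_weight n l
          * ((of_int (k + l - j) * fact (nat (k + l - j - 1)))
             * (of_int (j + l + 1 - k) * fact (nat (j + l + 1 - k))) * fact (nat (k + j - l - 1))
             / fact (nat (k + j + l)))"
      unfolding sixj_weight_def face_weight_def i of_int_mult by simp
    also have "\<dots> = (q k * of_int (j + l + 1 - k))\<^sup>2 * x k j"
      unfolding e f1[symmetric] f2 x_def face_weight_def power_mult_distrib by simp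
    finally show "((real n + 1)\<^sup>2 - (of_int k)\<^sup>2) * of_int ((l + (k - j)) * (l + 1 - (k - j)))
          * sixj_weight n (k - 1) j l = (q k * of_int (j + l + 1 - k))\<^sup>2 * x k j
        \<and> q k * of_int (j + l + 1 - k) \<ge> 0"
      using a q by (simp del: of_int_add of_int_diff)
  qed
  have x_swap: "x k j = x j k" unfolding x_def face_weight_def by (simp add: add_ac mult_ac)
  have d_swap: "ladder_diff l (k - j + 1) = ladder_diff l (j - k)"
    using ladder_diff_reflect[of l "j - k"] by (simp add: algebra_simps)
  have mid: "ladder_sum l (k + j - 1) * sixj n k j l
      = of_int (k + j - l) * sqrt (x k j) * racah_sum n k j l"
    unfolding ladder_sum_def
  proof (rule sqrt_times_sixj)
    assume adm: "sixj_admissible n k j l"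
    note a = adm[unfolded sixj_admissible_def]
    have f1: "of_int (k + j - l) * fact (nat (k + j - l))
        = (of_int (k + j - l))\<^sup>2 * (fact (nat (k + j - l - 1)) :: real)"
      using fact_nat_times_self[of "k + j - l"] a by simp
    have f2: "fact (nat (k + j + l + 1)) = of_int (k + j + l + 1) * (fact (nat (k + j + l)) :: real)"
      using fact_nat_plus_1[of "k + j + l"] k j l by simp
    have i: "(k + j - 1 + 2 + l) * (k + j - 1 + 1 - l) = (k + j + l + 1) * (k + j - l)"
      by (simp add: algebra_simps)
    have "of_int ((k + j - 1 + 2 + l) * (k + j - 1 + 1 - l)) * sixj_weight n k j l
        = of_int (k + j + l + 1) * edge_weight n k * edge_weight n j * edge_weight n l
          * ((of_int (k + j - l) * fact (nat (k + j - l))) * fact (nat (k + l - j)) * fact (nat (j + l - k))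
             / fact (nat (k + j + l + 1)))"
      unfolding sixj_weight_def face_weight_def i of_int_mult by simp
    also have "\<dots> = (of_int (k + j - l))\<^sup>2 * x k j"
    proof -
      have "real_of_int (k + j + l + 1) \<noteq> 0" using k j l by linarith
      then show ?thesis unfolding f1 x_def face_weight_def f2
        by (simp del: of_int_mult of_int_add of_int_diff add: divide_simps)
    qed
    finally show "of_int ((k + j - 1 + 2 + l) * (k + j - 1 + 1 - l)) * sixj_weight n k j l
        = (of_int (k + j - l))\<^sup>2 * x k j \<and> of_int (k + j - l) \<ge> (0 :: real)"
      using a by simp
  qed
  have kq: "of_int k * q k = (real n + 1)\<^sup>2 - (of_int k)\<^sup>2" "of_int j * q j = (real n + 1)\<^sup>2 - (of_int j)\<^sup>2"
    using k1 j by (simp_all add: q_def)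
  have "of_int j * (of_int k * q k) * of_int (j + l + 1 - k) * racah_sum n (k - 1) j l
       - of_int k * (of_int j * q j) * of_int (k + l + 1 - j) * racah_sum n k (j - 1) l
       - of_int (k * j * (k - j) * (k + j - l)) * racah_sum n k j l = 0"
    using racah_sum_contiguous_lower[of l k j n] k1 j l le unfolding kq by simp
  then have "of_int (k * j) * (q k * of_int (j + l + 1 - k) * racah_sum n (k - 1) j l
       - q j * of_int (k + l + 1 - j) * racah_sum n k (j - 1) l
       - of_int ((k - j) * (k + j - l)) * racah_sum n k j l) = 0"
    by (simp add: algebra_simps)
  then have "q k * of_int (j + l + 1 - k) * racah_sum n (k - 1) j l
       - q j * of_int (k + l + 1 - j) * racah_sum n k (j - 1) l
       - of_int ((k - j) * (k + j - l)) * racah_sum n k j l = 0"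
    using k1 j by simp
  then have "sqrt (x k j) * (q k * of_int (j + l + 1 - k) * racah_sum n (k - 1) j l
       - q j * of_int (k + l + 1 - j) * racah_sum n k (j - 1) l
       - of_int ((k - j) * (k + j - l)) * racah_sum n k j l) = 0" by simp
  moreover have "ladder_edge n j * ladder_diff l (k - j + 1) * sixj n k (j - 1) l
      = q j * of_int (k + l + 1 - j) * sqrt (x k j) * racah_sum n k (j - 1) l"
    using lower[OF j le(2), of k]
    unfolding x_swap[symmetric] d_swap sixj_swap12[of n "j - 1" k] racah_sum_swap12[of n "j - 1" k] .
  moreover have "of_int (k - j) * ladder_sum l (k + j - 1) * sixj n k j l
      = of_int (k - j) * (of_int (k + j - l) * sqrt (x k j) * racah_sum n k j l)"
    unfolding mid[symmetric] by simp
  ultimately show ?thesis using lower[OF k1 le(1), of j]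
    by (simp add: algebra_simps)
qed

section \<open>Comparison with Racah's formula\<close>

lemma rfact_of_nat: "rfact (int m) = 1 / fact m"
  by (simp add: rfact_def)

lemma rfact_int_diff: "b \<le> a \<Longrightarrow> rfact (int a - int b) = 1 / fact (a - b)"
  by (metis of_nat_diff rfact_of_nat)

text \<open>Racah's summation range consists of exactly those \<open>t = n + s\<close> for which no factorial argument is
  negative, which is where the summand written with \<open>rfact\<close> is nonzero. The signs \<open>(-1) ^ n\<close>
  disappear in the square.\<close>

lemma W3_sq_eq_sixj_sq:
  assumes N: "N \<ge> 1"
  shows "(W3 N k j l)\<^sup>2 = (sixj (N - 1) (int k) (int j) (int l))\<^sup>2"
proof -
  define n where "n = N - 1"
  have adm: "triad (2 * k) (2 * j) (2 * l) \<and> triad (2 * k) n n \<and> triad n (2 * j) n \<and> triad n n (2 * l)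
      \<longleftrightarrow> sixj_admissible n (int k) (int j) (int l)"
  proof -
    have even: "even (2 * k + 2 * j + 2 * l)" "even (2 * k + n + n)" "even (n + 2 * j + n)" "even (n + n + 2 * l)"
      by simp_all
    have t: "triad (2 * k) (2 * j) (2 * l) \<longleftrightarrow> k \<le> j + l \<and> j \<le> k + l \<and> l \<le> k + j"
      "triad (2 * k) n n \<longleftrightarrow> k \<le> n" "triad n (2 * j) n \<longleftrightarrow> j \<le> n" "triad n n (2 * l) \<longleftrightarrow> l \<le> n"
      unfolding triad_def using even by linarith+
    have a: "sixj_admissible n (int k) (int j) (int l) \<longleftrightarrow> k \<le> n \<and> j \<le> n \<and> l \<le> n
        \<and> k \<le> j + l \<and> j \<le> k + l \<and> l \<le> k + j"
      unfolding sixj_admissible_def of_nat_add[symmetric] of_nat_le_iff by (rule refl)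
    show ?thesis unfolding t a by (intro iffI; elim conjE; intro conjI; assumption)
  qed
  show ?thesis
  proof (cases "sixj_admissible n (int k) (int j) (int l)")
    case False
    have "W3 N k j l = 0"
      unfolding W3_def wigner_6j_def n_def[symmetric] using False[folded adm] by (rule if_not_P)
    then show ?thesis using False unfolding n_def[symmetric] by (simp add: sixj_inadmissible)
  next
    case True
    note a = True[unfolded sixj_admissible_def]
    have le: "k \<le> n" "j \<le> n" "l \<le> n" "k \<le> j + l" "j \<le> k + l" "l \<le> k + j"
      using a by linarith+
    define f where "f t = (-1) ^ t * fact (t + 1) / (fact (t - (k + j + l)) * fact (t - (k + n))
        * fact (t - (n + j)) * fact (t - (n + l)) * fact (k + j + n - t) * fact (j + l + n - t)
        * fact (k + l + n - t) :: real)" for t :: nat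
    define A where "A = max (max (k + j + l) (k + n)) (max (n + j) (n + l))"
    define B where "B = min (k + j + n) (min (j + l + n) (k + l + n))"
    have term_eq: "f (s + n) = (-1) ^ n * racah_term n (int k) (int j) (int l) s"
      if "s + n \<in> {A..B}" for s
    proof -
      have b: "k + j + l \<le> n + s" "k \<le> s" "j \<le> s" "l \<le> s" "s \<le> k + j" "s \<le> j + l" "s \<le> k + l"
        using that unfolding A_def B_def by auto
      have e: "int n + int s - int k - int j - int l = int (n + s) - int (k + j + l)"
        "int k + int j - int s = int (k + j) - int s" "int j + int l - int s = int (j + l) - int s"
        "int k + int l - int s = int (k + l) - int s" by simp_all
      show ?thesis
        unfolding f_def racah_term_def e rfact_int_diff[OF b(1)] rfact_int_diff[OF b(2)]
          rfact_int_diff[OF b(3)] rfact_int_diff[OF b(4)] rfact_int_diff[OF b(5)]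
          rfact_int_diff[OF b(6)] rfact_int_diff[OF b(7)]
        by (simp add: power_add add_ac mult_ac del: fact_Suc)
    qed
    have zero: "racah_term n (int k) (int j) (int l) s = 0" if "s + n \<notin> {A..B}" for s
    proof -
      have "int n + int s - int k - int j - int l < 0 \<or> int s - int k < 0 \<or> int s - int j < 0
          \<or> int s - int l < 0 \<or> int k + int j - int s < 0 \<or> int j + int l - int s < 0
          \<or> int k + int l - int s < 0"
        using that unfolding A_def B_def by auto
      then show ?thesis unfolding racah_term_def by (elim disjE) simp_all
    qed
    have "(\<Sum>t = A..B. f t) = (\<Sum>s \<in> {s. s < 2 * n + 4 \<and> s + n \<in> {A..B}}. f (s + n))"
    proof (rule sum.reindex_bij_witness[where i = "\<lambda>s. s + n" and j = "\<lambda>t. t - n"])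
      fix t assume "t \<in> {A..B}"
      then show "t - n \<in> {s. s < 2 * n + 4 \<and> s + n \<in> {A..B}}" "t - n + n = t"
        using le unfolding A_def B_def by auto
      then show "f (t - n + n) = f t" by simp
    qed auto
    also have "\<dots> = (\<Sum>s \<in> {s. s < 2 * n + 4 \<and> s + n \<in> {A..B}}.
        (-1) ^ n * racah_term n (int k) (int j) (int l) s)"
      by (intro sum.cong) (simp_all add: term_eq)
    also have "\<dots> = (\<Sum>s < 2 * n + 4. (-1) ^ n * racah_term n (int k) (int j) (int l) s)"
      by (rule sum.mono_neutral_left) (auto simp: zero)
    finally have sum: "(\<Sum>t = A..B. f t) = (-1) ^ n * racah_sum n (int k) (int j) (int l)"
      by (simp add: racah_sum_def sum_distrib_left)
    have edge: "(triangle_coeff (2 * i) n n)\<^sup>2 = edge_weight n (int i)"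
      "(triangle_coeff n (2 * i) n)\<^sup>2 = edge_weight n (int i)"
      "(triangle_coeff n n (2 * i))\<^sup>2 = edge_weight n (int i)" if "i \<le> n" for i
    proof -
      have d: "(2 * i + n - n) div 2 = i" "(n + n - 2 * i) div 2 = n - i" "(2 * i + n + n) div 2 = n + i"
        "(n + 2 * i - n) div 2 = i" "(n + 2 * i + n) div 2 = n + i" "(n + n + 2 * i) div 2 = n + i"
        using that by auto
      have "nat (int n - int i) = n - i" "nat (int n + int i + 1) = n + i + 1" using that by auto
      then show "(triangle_coeff (2 * i) n n)\<^sup>2 = edge_weight n (int i)"
        "(triangle_coeff n (2 * i) n)\<^sup>2 = edge_weight n (int i)"
        "(triangle_coeff n n (2 * i))\<^sup>2 = edge_weight n (int i)"
        unfolding triangle_coeff_def edge_weight_def d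
        by (simp_all add: power2_eq_square mult_ac del: fact_Suc)
    qed
    have face: "(triangle_coeff (2 * k) (2 * j) (2 * l))\<^sup>2
        = face_weight (int k + int j - int l) (int k + int l - int j) (int j + int l - int k)
            (int k + int j + int l + 1)"
    proof -
      have d: "(2 * k + 2 * j - 2 * l) div 2 = k + j - l" "(2 * k + 2 * l - 2 * j) div 2 = k + l - j"
        "(2 * j + 2 * l - 2 * k) div 2 = j + l - k" "(2 * k + 2 * j + 2 * l) div 2 = k + j + l"
        by auto
      have "nat (int k + int j - int l) = k + j - l" "nat (int k + int l - int j) = k + l - j"
        "nat (int j + int l - int k) = j + l - k" "nat (int k + int j + int l + 1) = k + j + l + 1"
        using le by auto
      then show ?thesis unfolding triangle_coeff_def face_weight_def d by (simp del: fact_Suc)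
    qed
    have p: "(2 * k + 2 * j + 2 * l) div 2 = k + j + l" "(2 * k + n + n) div 2 = k + n"
      "(n + 2 * j + n) div 2 = n + j" "(n + n + 2 * l) div 2 = n + l"
      "(2 * k + 2 * j + n + n) div 2 = k + j + n" "(2 * j + 2 * l + n + n) div 2 = j + l + n"
      "(2 * k + 2 * l + n + n) div 2 = k + l + n"
      by auto
    have "W3 N k j l = triangle_coeff (2 * k) (2 * j) (2 * l) * triangle_coeff (2 * k) n n
        * triangle_coeff n (2 * j) n * triangle_coeff n n (2 * l) * (\<Sum>t = A..B. f t)"
      unfolding W3_def wigner_6j_def n_def[symmetric] if_P[OF True[folded adm]] p Let_def A_def B_def f_def
      by (rule refl)
    then have "(W3 N k j l)\<^sup>2 = sixj_weight n (int k) (int j) (int l)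
        * (racah_sum n (int k) (int j) (int l))\<^sup>2"
      unfolding sum using edge le face
      by (simp add: power_mult_distrib sixj_weight_def power_mult[symmetric] mult_ac)
    moreover have "sixj_weight n (int k) (int j) (int l) \<ge> 0"
      by (simp add: sixj_weight_def edge_weight_nonneg face_weight_nonneg)
    ultimately show ?thesis unfolding n_def[symmetric]
      by (simp add: sixj_def power_mult_distrib)
  qed
qed

section \<open>Orthogonality\<close>

lemma ladder_edge_top: "ladder_edge n (int n + 1) = 0"
  by (simp add: ladder_edge_def)

text \<open>Why the orthogonality sum does not depend on \<open>j\<close>: the difference of its summands for \<open>j + 1\<close> and
  \<open>j\<close> is a difference \<open>g (k + 1) - g k\<close>. Write \<open>u, v\<close> for the symbols at \<open>(k, j)\<close> and
  \<open>(k, j + 1)\<close>. The contiguous relations express the four products of neighbours in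
  \<open>g (k + 1) - g k\<close> through \<open>u\<close> and \<open>v\<close>; the mixed terms \<open>u * v\<close> cancel, and what remains is
  \<open>(c\<^sup>2 + b\<^sup>2) * (v\<^sup>2 - u\<^sup>2)\<close> with \<open>c\<^sup>2 + b\<^sup>2 = (2 * k + 1) * (2 * j + 2)\<close>.\<close>

lemma sixj_sq_telescopes_in_j:
  fixes n :: nat and k j l :: int
  assumes k: "0 \<le> k" and j: "0 \<le> j" and l: "0 \<le> l" and le: "k \<le> int n" "j < int n" "j < l"
  defines "g \<equiv> \<lambda>k. ladder_edge n k / (2 * of_int (j + 1) * ladder_edge n (j + 1))
     * (ladder_diff l (k - j) * ladder_diff l (k - j - 1) * sixj n k j l * sixj n (k - 1) (j + 1) l
        + ladder_sum l (k + j) * ladder_sum l (k + j - 1) * sixj n (k - 1) j l * sixj n k (j + 1) l)"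
  shows "of_int (2 * k + 1) * ((sixj n k (j + 1) l)\<^sup>2 - (sixj n k j l)\<^sup>2) = g (k + 1) - g k"
proof -
  define a ap am a1 where "a = ladder_edge n (j + 1)" and "ap = ladder_edge n (k + 1)"
    and "am = ladder_edge n k" and "a1 = (2 * real_of_int (j + 1))"
  define c cp cm where "c = ladder_diff l (k - j)" and "cp = ladder_diff l (k - j + 1)"
    and "cm = ladder_diff l (k - j - 1)"
  define b bp bm where "b = ladder_sum l (k + j)" and "bp = ladder_sum l (k + j + 1)"
    and "bm = ladder_sum l (k + j - 1)"
  define u up um v vp vm where "u = sixj n k j l" and "up = sixj n (k + 1) j l"
    and "um = sixj n (k - 1) j l" and "v = sixj n k (j + 1) l"
    and "vp = sixj n (k + 1) (j + 1) l" and "vm = sixj n (k - 1) (j + 1) l"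
  note d = a_def a1_def ap_def am_def c_def cp_def cm_def b_def bp_def bm_def
    u_def up_def um_def v_def vp_def vm_def
  have r1: "ap * cp * up = a * c * v + of_int (k - j) * b * u"
    using sixj_contiguous_raise[of k j l n] assms unfolding d by simp
  have r2: "bp * ap * vp = - b * a * u - of_int (k + j + 2) * c * v"
  proof -
    have "ladder_diff l (j + 1 - k) = ladder_diff l (k - j)"
      using ladder_diff_reflect[of l "k - j"] by (simp add: algebra_simps)
    then show ?thesis
      using sixj_contiguous_mixed[of "j + 1" k l n, unfolded sixj_swap12[of n "j + 1"]
          sixj_swap12[of n "j + 1 - 1"]] assms
      unfolding d by (simp add: algebra_simps)
  qed
  have r3: "bm * am * um = - b * a * v - of_int (k + j + 1) * c * u"
    using sixj_contiguous_mixed[of k j l n] assms unfolding d by (simp add: mult_ac)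
  have r4: "am * cm * vm = a * c * u + of_int (k - j - 1) * b * v"
    using sixj_contiguous_lower[of k "j + 1" l n] assms unfolding d by (simp add: algebra_simps)
  have cb: "c\<^sup>2 * (v\<^sup>2 - u\<^sup>2) + b\<^sup>2 * (v\<^sup>2 - u\<^sup>2) = of_int (2 * k + 1) * a1 * (v\<^sup>2 - u\<^sup>2)"
  proof (cases "sixj_admissible n k j l \<or> sixj_admissible n k (j + 1) l")
    case True
    then have t: "k \<le> j + l + 1" "j \<le> k + l" "l \<le> k + j + 1" "0 \<le> l + (k - j)"
      unfolding sixj_admissible_def by linarith+
    have "c\<^sup>2 = of_int ((l + (k - j)) * (l + 1 - (k - j)))"
      unfolding c_def ladder_diff_def using t by (intro real_sqrt_pow2) (simp del: of_int_mult)
    moreover have "b\<^sup>2 = of_int ((k + j + 2 + l) * (k + j + 1 - l))"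
      unfolding b_def ladder_sum_def using t l j k by (intro real_sqrt_pow2) (simp del: of_int_mult)
    ultimately have "c\<^sup>2 + b\<^sup>2 = of_int (2 * k + 1) * a1"
      unfolding a1_def by (simp add: algebra_simps)
    then show ?thesis by (metis distrib_right)
  next
    case False
    then show ?thesis by (simp add: u_def v_def sixj_inadmissible)
  qed
  have a: "a > 0"
  proof -
    have "(real_of_int (j + 1))\<^sup>2 < (real n + 1)\<^sup>2" using j le by (intro power_strict_mono) linarith+
    then show ?thesis by (simp add: a_def ladder_edge_def)
  qed
  have a1: "a1 > 0" using j by (simp add: a1_def)
  have g: "g (k + 1) - g k = (c * v * (ap * cp * up) + b * u * (bp * ap * vp)
      - c * u * (am * cm * vm) - b * v * (bm * am * um)) / (a1 * a)"
    unfolding g_def d by (simp add: algebra_simps diff_divide_distrib add_divide_distrib)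
  also have "\<dots> = a * (c\<^sup>2 * (v\<^sup>2 - u\<^sup>2) + b\<^sup>2 * (v\<^sup>2 - u\<^sup>2)) / (a1 * a)"
    unfolding r1 r2 r3 r4 by (simp add: algebra_simps power2_eq_square)
  also have "\<dots> = of_int (2 * k + 1) * (v\<^sup>2 - u\<^sup>2)"
    unfolding cb using a a1 by simp
  finally show ?thesis by (simp add: u_def v_def)
qed

text \<open>For \<open>j = 0\<close> the triangle conditions leave only \<open>k = l\<close>, and Racah's sum has the single term
  \<open>s = l\<close>.\<close>

lemma sixj_orthogonality_zero:
  fixes n l :: nat
  assumes "l \<le> n"
  shows "(\<Sum>k = 0..n. (2 * real k + 1) * (sixj n (int k) 0 (int l))\<^sup>2) = 1 / (real n + 1)"
proof -
  have off: "sixj n (int k) 0 (int l) = 0" if "k \<noteq> l" for k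
    using that by (intro sixj_inadmissible) (auto simp: sixj_admissible_def)
  have "racah_term n (int l) 0 (int l) s = 0" if "s \<noteq> l" for s
  proof -
    have "int l - int s < 0 \<or> int s - int l < 0" using that by linarith
    then show ?thesis unfolding racah_term_def by (elim disjE) simp_all
  qed
  then have "racah_sum n (int l) 0 (int l) = (\<Sum>s \<in> {l}. racah_term n (int l) 0 (int l) s)"
    unfolding racah_sum_def using assms by (intro sum.mono_neutral_right) auto
  also have "\<dots> = (-1) ^ l * fact (n + l + 1) / (fact (n - l) * (fact l)\<^sup>2)"
    using rfact_of_nat[of "n - l"] rfact_of_nat[of l] rfact_of_nat[of 0] assms
    by (simp add: racah_term_def of_nat_diff power2_eq_square del: fact_Suc)
  finally have R: "(racah_sum n (int l) 0 (int l))\<^sup>2 = (fact (n + l + 1))\<^sup>2 / ((fact (n - l))\<^sup>2 * (fact l) ^ 4)"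
    by (simp add: power_divide power_mult_distrib power_mult[symmetric] del: fact_Suc)
  have e0: "edge_weight n 0 = 1 / (real n + 1)"
  proof -
    have "(fact (nat (int n + 1)) :: real) = (real n + 1) * fact n"
      using fact_nat_plus_1[of "int n"] by simp
    then show ?thesis by (simp add: edge_weight_def)
  qed
  have el: "edge_weight n (int l) = (fact l)\<^sup>2 * fact (n - l) / fact (n + l + 1)"
  proof -
    have "nat (int n - int l) = n - l" "nat (int n + int l + 1) = n + l + 1" using assms by auto
    then show ?thesis by (simp add: edge_weight_def del: fact_Suc)
  qed
  have face: "face_weight (int l + 0 - int l) (int l + int l - 0) (0 + int l - int l) (int l + 0 + int l + 1)
      = 1 / (2 * real l + 1)"
  proof -
    have "(fact (nat (int l + int l + 1)) :: real) = (2 * real l + 1) * fact (nat (int l + int l))"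
      using fact_nat_plus_1[of "int l + int l"] by simp
    then show ?thesis unfolding face_weight_def by (simp del: fact_Suc)
  qed
  have w: "sixj_weight n (int l) 0 (int l) = (fact l) ^ 4 * (fact (n - l))\<^sup>2 / (fact (n + l + 1))\<^sup>2
      / ((real n + 1) * (2 * real l + 1))"
    unfolding sixj_weight_def e0 el face
    by (simp add: power_divide power_mult_distrib power2_eq_square power4_eq_xxxx mult_ac del: fact_Suc)
  then have "sixj_weight n (int l) 0 (int l) \<ge> 0" by simp
  then have "(sixj n (int l) 0 (int l))\<^sup>2 = 1 / ((real n + 1) * (2 * real l + 1))"
    unfolding sixj_def power_mult_distrib by (simp add: R w del: fact_Suc)
  then have "(2 * real l + 1) * (sixj n (int l) 0 (int l))\<^sup>2 = 1 / (real n + 1)" by simp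
  moreover have "(\<Sum>k = 0..n. (2 * real k + 1) * (sixj n (int k) 0 (int l))\<^sup>2)
      = (\<Sum>k \<in> {l}. (2 * real k + 1) * (sixj n (int k) 0 (int l))\<^sup>2)"
    using assms by (intro sum.mono_neutral_right) (auto simp: off)
  ultimately show ?thesis by simp
qed

text \<open>Induction on the smaller of \<open>j\<close> and \<open>l\<close>. At the ends of the telescoping sum \<open>g\<close> vanishes:
  at \<open>0\<close> because it involves symbols with entry \<open>-1\<close>, at \<open>n + 1\<close> because
  \<open>ladder_edge n (n + 1) = 0\<close>.\<close>

theorem sixj_orthogonality:
  fixes n j l :: nat
  assumes "j \<le> n" "l \<le> n"
  shows "(\<Sum>k = 0..n. (2 * real k + 1) * (sixj n (int k) (int j) (int l))\<^sup>2) = 1 / (real n + 1)"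
proof -
  have le: "(\<Sum>k = 0..n. (2 * real k + 1) * (sixj n (int k) (int j) (int l))\<^sup>2) = 1 / (real n + 1)"
    if "j \<le> l" "l \<le> n" for j l
    using that(1)
  proof (induction j)
    case 0
    then show ?case using sixj_orthogonality_zero[OF that(2)] by simp
  next
    case (Suc j)
    define g where "g k = ladder_edge n k / (2 * of_int (int j + 1) * ladder_edge n (int j + 1))
     * (ladder_diff (int l) (k - int j) * ladder_diff (int l) (k - int j - 1)
          * sixj n k (int j) (int l) * sixj n (k - 1) (int j + 1) (int l)
        + ladder_sum (int l) (k + int j) * ladder_sum (int l) (k + int j - 1)
          * sixj n (k - 1) (int j) (int l) * sixj n k (int j + 1) (int l))" for k
    have "(\<Sum>k = 0..n. (2 * real k + 1) * (sixj n (int k) (int (Suc j)) (int l))\<^sup>2)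
        - (\<Sum>k = 0..n. (2 * real k + 1) * (sixj n (int k) (int j) (int l))\<^sup>2)
        = (\<Sum>k = 0..n. g (int (Suc k)) - g (int k))"
      unfolding sum_subtractf[symmetric]
    proof (intro sum.cong refl)
      fix k assume "k \<in> {0..n}"
      then show "(2 * real k + 1) * (sixj n (int k) (int (Suc j)) (int l))\<^sup>2
          - (2 * real k + 1) * (sixj n (int k) (int j) (int l))\<^sup>2 = g (int (Suc k)) - g (int k)"
        using sixj_sq_telescopes_in_j[of "int k" "int j" "int l" n] Suc.prems that
        unfolding g_def by (simp add: right_diff_distrib add.commute)
    qed
    also have "\<dots> = g (int (Suc n)) - g (int 0)"
      by (rule sum_Suc_diff) simp
    also have "\<dots> = 0"
      using sixj_inadmissible[of n "-1" "int j" "int l"] sixj_inadmissible[of n "-1" "int j + 1" "int l"]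
        ladder_edge_top[of n]
      by (simp add: g_def sixj_admissible_def add.commute)
    finally show ?case using Suc by simp
  qed
  show ?thesis
  proof (cases "j \<le> l")
    case False
    then show ?thesis using le[of l j] assms by (simp add: sixj_swap23[of n _ "int j"])
  qed (use le assms in simp)
qed

section \<open>Alternating sums\<close>

text \<open>The linear combination of \<open>sixj_contiguous_raise\<close> and \<open>sixj_contiguous_mixed\<close> in which the
  neighbour at \<open>j + 1\<close> cancels.\<close>

lemma sixj_three_term:
  fixes n :: nat and k j l :: int
  assumes k: "0 \<le> k" and j: "0 \<le> j" and l: "0 \<le> l" and le: "k \<le> int n" "j \<le> int n"
  defines "e \<equiv> \<lambda>k. ladder_edge n k * ladder_diff l (k - j) * ladder_sum l (k + j - 1)"
  shows "e (k + 1) * sixj n (k + 1) j l + e k * sixj n (k - 1) j l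
       = of_int ((2 * k + 1) * (k * (k + 1) - j * (j + 1) - l * (l + 1))) * sixj n k j l"
proof (cases "sixj_admissible n k j l")
  case True
  define b c u where "b = ladder_sum l (k + j)" and "c = ladder_diff l (k - j)" and "u = sixj n k j l"
  have t: "k \<le> j + l" "j \<le> k + l" "l \<le> k + j" using True unfolding sixj_admissible_def by auto
  have c2: "c\<^sup>2 = of_int ((l + (k - j)) * (l + 1 - (k - j)))"
    unfolding c_def ladder_diff_def using t by (intro real_sqrt_pow2) (simp del: of_int_mult)
  have b2: "b\<^sup>2 = of_int ((k + j + 2 + l) * (k + j + 1 - l))"
    unfolding b_def ladder_sum_def using t l j k by (intro real_sqrt_pow2) (simp del: of_int_mult)
  have r1: "ladder_edge n (k + 1) * ladder_diff l (k - j + 1) * sixj n (k + 1) j l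
      = ladder_edge n (j + 1) * c * sixj n k (j + 1) l + of_int (k - j) * b * u"
    using sixj_contiguous_raise[of k j l n] assms unfolding b_def c_def u_def by simp
  have r2: "ladder_sum l (k + j - 1) * ladder_edge n k * sixj n (k - 1) j l
      = - b * ladder_edge n (j + 1) * sixj n k (j + 1) l - of_int (k + j + 1) * c * u"
    using sixj_contiguous_mixed[of k j l n] assms unfolding b_def c_def u_def by simp
  have i: "k + 1 - j = k - j + 1" "k + 1 + j - 1 = k + j" by simp_all
  have "e (k + 1) * sixj n (k + 1) j l + e k * sixj n (k - 1) j l
      = b * (ladder_edge n (k + 1) * ladder_diff l (k - j + 1) * sixj n (k + 1) j l)
        + c * (ladder_sum l (k + j - 1) * ladder_edge n k * sixj n (k - 1) j l)"
    unfolding e_def b_def c_def i by (simp add: mult_ac)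
  also have "\<dots> = (of_int (k - j) * b\<^sup>2 - of_int (k + j + 1) * c\<^sup>2) * u"
    unfolding r1 r2 by (simp add: algebra_simps power2_eq_square)
  also have "of_int (k - j) * b\<^sup>2 - of_int (k + j + 1) * c\<^sup>2
      = of_int ((2 * k + 1) * (k * (k + 1) - j * (j + 1) - l * (l + 1)))"
    unfolding b2 c2 by (simp add: algebra_simps)
  finally show ?thesis unfolding u_def .
next
  case False
  have "ladder_edge n (k + 1) * ladder_diff l (k + 1 - j) * ladder_sum l (k + j) * sixj n (k + 1) j l = 0"
  proof (cases "sixj_admissible n (k + 1) j l")
    case True
    then have "l = k + j + 1 \<or> j = k + 1 + l"
      using False unfolding sixj_admissible_def by linarith
    then show ?thesis by (auto simp: ladder_diff_def ladder_sum_def)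
  qed (simp add: sixj_inadmissible)
  moreover have "ladder_edge n k * ladder_diff l (k - j) * ladder_sum l (k + j - 1) * sixj n (k - 1) j l = 0"
  proof (cases "sixj_admissible n (k - 1) j l")
    case True
    then have "k = j + l + 1"
      using False le unfolding sixj_admissible_def by linarith
    then show ?thesis by (auto simp: ladder_diff_def)
  qed (simp add: sixj_inadmissible)
  moreover have "k + 1 + j - 1 = k + j" by simp
  ultimately show ?thesis using False by (auto simp: e_def sixj_inadmissible)
qed

text \<open>Multiply the three-term recurrence by \<open>(-1) ^ k\<close> times the symbol at \<open>k\<close> and sum. The product of the
  symbols at \<open>k\<close> and \<open>k + 1\<close> arises from two consecutive values of the index, with opposite signs, so
  the left side cancels. This turns the alternating sum with weight \<open>lam k\<close>, given by hypothesis in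
  the theorem, into the one without that weight.\<close>

lemma sixj_alternating_sum:
  fixes n j l :: nat
  assumes "j \<le> n"
  shows "(\<Sum>k = 0..n. (-1) ^ k * (lam k * (2 * real k + 1)) * (sixj n (int k) (int j) (int l))\<^sup>2)
    = (lam j + lam l) * (\<Sum>k = 0..n. (-1) ^ k * (2 * real k + 1) * (sixj n (int k) (int j) (int l))\<^sup>2)"
proof -
  define e where "e k = ladder_edge n k * ladder_diff (int l) (k - int j) * ladder_sum (int l) (k + int j - 1)" for k
  define u where "u k = sixj n k (int j) (int l)" for k
  define h where "h k = - ((-1) ^ k) * e (int k) * u (int k) * u (int k - 1)" for k :: nat
  have step: "(-1) ^ k * (2 * real k + 1) * (lam k - lam j - lam l) * (u (int k))\<^sup>2 = h (Suc k) - h k"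
    if "k \<in> {0..n}" for k
  proof -
    have i: "int (Suc k) - 1 = int k" "int (Suc k) = int k + 1" by simp_all
    have "e (int k + 1) * u (int k + 1) + e (int k) * u (int k - 1)
        = (2 * real k + 1) * (lam k - lam j - lam l) * u (int k)"
      using sixj_three_term[of "int k" "int j" "int l" n] that assms
      by (simp add: e_def u_def lam_def algebra_simps)
    then have "(-1) ^ k * u (int k) * (e (int k + 1) * u (int k + 1) + e (int k) * u (int k - 1))
        = (-1) ^ k * u (int k) * ((2 * real k + 1) * (lam k - lam j - lam l) * u (int k))" by simp
    then show ?thesis unfolding h_def i by (simp add: algebra_simps power2_eq_square)
  qed
  have "(\<Sum>k = 0..n. (-1) ^ k * (2 * real k + 1) * (lam k - lam j - lam l) * (u (int k))\<^sup>2)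
      = (\<Sum>k = 0..n. h (Suc k) - h k)" by (intro sum.cong refl step)
  also have "\<dots> = h (Suc n) - h 0" by (rule sum_Suc_diff) simp
  also have "\<dots> = 0"
    using sixj_inadmissible[of n "-1" "int j" "int l"] ladder_edge_top[of n]
    by (simp add: h_def e_def u_def sixj_admissible_def add.commute)
  finally have "(\<Sum>k = 0..n. (-1) ^ k * (2 * real k + 1) * (lam k - lam j - lam l) * (u (int k))\<^sup>2) = 0" .
  then have "(\<Sum>k = 0..n. (-1) ^ k * (lam k * (2 * real k + 1)) * (u (int k))\<^sup>2)
      - (\<Sum>k = 0..n. (lam j + lam l) * ((-1) ^ k * (2 * real k + 1) * (u (int k))\<^sup>2)) = 0"
    unfolding sum_subtractf[symmetric] by (simp add: algebra_simps)
  then show ?thesis by (simp add: sum_distrib_left u_def)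
qed

section \<open>Harmonic sums\<close>

lemma harm_real_Suc: "(harm (Suc m) :: real) = harm m + 1 / (real m + 1)"
  by (simp add: harm_Suc inverse_eq_divide add.commute)

lemma sum_reciprocals_below:
  fixes l m :: nat
  assumes "m < l"
  shows "(\<Sum>k = 1..m. 1 / real k + 1 / (real k + 1) + 1 / (real l - real k) - 1 / (real l + real k + 1))
    = harm m + harm (m + 1) - 1 + harm (l - 1) - harm (l - 1 - m) - harm (l + m + 1) + harm (l + 1)"
  using assms
proof (induction m)
  case 0
  then show ?case by (simp add: harm_real_Suc[of 0] harm_expand(1))
next
  case (Suc m)
  define q where "q = l - 1 - Suc m"
  have "l - 1 - m = Suc q" "real l = real q + real m + 2" using Suc.prems by (auto simp: q_def)
  then show ?case using Suc unfolding q_def[symmetric]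
    by (simp add: harm_real_Suc algebra_simps)
qed

lemma sum_reciprocals_above:
  fixes l m :: nat
  shows "(\<Sum>k = l + 1..l + m. 1 / (real k - real l) + 1 / (real k + real l + 1) - 1 / real k - 1 / (real k + 1))
    = harm m + harm (m + 2 * l + 1) - harm (2 * l + 1)
      - (harm (m + l) - harm l) - (harm (m + l + 1) - harm (l + 1))"
proof (induction m)
  case (Suc m)
  have "(\<Sum>k = l + 1..l + Suc m. 1 / (real k - real l) + 1 / (real k + real l + 1) - 1 / real k - 1 / (real k + 1))
      = (\<Sum>k = l + 1..l + m. 1 / (real k - real l) + 1 / (real k + real l + 1) - 1 / real k - 1 / (real k + 1))
        + (1 / (real m + 1) + 1 / (real m + 2 * real l + 2) - 1 / (real m + real l + 1) - 1 / (real m + real l + 2))"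
    by (simp add: algebra_simps)
  then show ?case unfolding Suc.IH by (simp add: harm_real_Suc algebra_simps)
qed (simp add: harm_expand(1))

text \<open>Shifting an index up by one in the shorter and down by one in the longer harmonic number increases
  the sum, since the reciprocals decrease.\<close>

lemma harm_spread:
  fixes m l :: nat
  shows "(harm m + harm (m + 2 * l + 1) :: real) \<le> harm (m + l) + harm (m + l + 1)"
proof (induction l arbitrary: m)
  case (Suc l)
  have "(harm m + harm (m + 2 * Suc l + 1) :: real)
      = harm (Suc m) + harm (Suc m + 2 * l + 1) + (1 / (real m + 2 * real l + 3) - 1 / (real m + 1))"
    by (simp add: harm_real_Suc algebra_simps)
  also have "\<dots> \<le> harm (Suc m) + harm (Suc m + 2 * l + 1)"
    by (simp add: frac_le)
  also have "\<dots> \<le> harm (Suc m + l) + harm (Suc m + l + 1)" by (rule Suc.IH)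
  finally show ?case by simp
qed simp

text \<open>The product \<open>\<bar>k - l\<bar> * (k + l + 1)\<close> is \<open>\<bar>lam k - lam l\<bar>\<close>, so partial fractions turn the summand into
  reciprocals of \<open>k\<close>, \<open>k + 1\<close>, \<open>\<bar>k - l\<bar>\<close> and \<open>k + l + 1\<close>, with signs depending on whether \<open>k < l\<close>.
  Both parts then sum to harmonic numbers, and the terms that depend on \<open>n\<close> have a favourable sign by
  \<open>harm_spread\<close>.\<close>

lemma sum_resolvent_le_harm:
  fixes n l :: nat
  assumes "1 \<le> l" "l \<le> n"
  shows "(\<Sum>k \<in> {1..n} - {l}. lam l * (2 * real k + 1) / (lam k * (\<bar>real k - real l\<bar> * (real k + real l + 1))))
    \<le> 4 * harm l"
proof -
  let ?f = "\<lambda>k. lam l * (2 * real k + 1) / (lam k * (\<bar>real k - real l\<bar> * (real k + real l + 1)))"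
  define q where "q = l - 1"
  have q: "l = Suc q" using assms by (simp add: q_def)
  define m where "m = n - l"
  have m: "n = l + m" using assms by (simp add: m_def)
  have "{1..n} - {l} = {1..q} \<union> {l + 1..l + m}" by (auto simp: q m)
  then have split: "sum ?f ({1..n} - {l}) = sum ?f {1..q} + sum ?f {l + 1..l + m}"
    by (simp only:) (rule sum.union_disjoint, auto simp: q)
  have below: "sum ?f {1..q}
      = (\<Sum>k = 1..q. 1 / real k + 1 / (real k + 1) + 1 / (real l - real k) - 1 / (real l + real k + 1))"
  proof (intro sum.cong refl)
    fix k assume "k \<in> {1..q}"
    then have k: "k \<ge> 1" "k < l" by (auto simp: q)
    define d where "d = real l - real k"
    have d: "d > 0" "real l = real k + d" using k by (auto simp: d_def)
    have "\<bar>real k - real l\<bar> = d" using d by simp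
    moreover have "real k > 0" using k by simp
    ultimately show "?f k = 1 / real k + 1 / (real k + 1) + 1 / (real l - real k) - 1 / (real l + real k + 1)"
      using d unfolding lam_def d(2) by (simp add: divide_simps) (simp add: algebra_simps)
  qed
  have above: "sum ?f {l + 1..l + m}
      = (\<Sum>k = l + 1..l + m. 1 / (real k - real l) + 1 / (real k + real l + 1) - 1 / real k - 1 / (real k + 1))"
  proof (intro sum.cong refl)
    fix k assume "k \<in> {l + 1..l + m}"
    then have k: "k > l" by auto
    define d where "d = real k - real l"
    have d: "d > 0" "real k = real l + d" using k by (auto simp: d_def)
    have "\<bar>real k - real l\<bar> = d" using d by simp
    moreover have "real l > 0" using assms by simp
    ultimately show "?f k = 1 / (real k - real l) + 1 / (real k + real l + 1) - 1 / real k - 1 / (real k + 1)"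
      using d unfolding lam_def d(2) by (simp add: divide_simps) (simp add: algebra_simps)
  qed
  have "sum ?f {1..q} = 2 * harm q + 2 * harm l - 1 + 1 / (real l + 1) - harm (2 * l)"
  proof -
    have i: "q + 1 = l" "l - 1 = q" "q - q = 0" "l + q + 1 = 2 * l" by (simp_all add: q)
    have "sum ?f {1..q} = harm (q + 1) + harm q - 1 + harm (l - 1) - harm (l - 1 - q) - harm (l + q + 1) + harm (l + 1)"
      unfolding below using sum_reciprocals_below[of q l] by (simp add: q)
    then show ?thesis unfolding i by (simp add: harm_real_Suc harm_expand(1))
  qed
  moreover have "sum ?f {l + 1..l + m} \<le> 2 * harm l + 1 / (real l + 1) - harm (2 * l + 1)"
    unfolding above sum_reciprocals_above using harm_spread[of m l]
    by (simp add: harm_real_Suc[of l])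
  moreover have "harm q = harm l - 1 / real l" by (simp add: q harm_real_Suc add.commute)
  moreover have "harm l \<le> (harm (2 * l) :: real)" "harm l \<le> (harm (2 * l + 1) :: real)"
    by (intro harm_mono; simp)+
  moreover have "1 / (real l + 1) \<le> 1 / real l" using assms by (simp add: frac_le)
  ultimately show ?thesis unfolding split by linarith
qed

section \<open>The Ricci curvature\<close>

lemma sum_odd_eq_half_difference:
  fixes f :: "nat \<Rightarrow> real"
  assumes "finite A"
  shows "(\<Sum>k \<in> {k \<in> A. odd (k + m)}. f k) = ((\<Sum>k\<in>A. f k) - (-1) ^ m * (\<Sum>k\<in>A. (-1) ^ k * f k)) / 2"
proof -
  have "(\<Sum>k \<in> {k \<in> A. odd (k + m)}. f k) = (\<Sum>k\<in>A. if odd (k + m) then f k else 0)"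
    using assms by (rule sum.inter_filter)
  also have "\<dots> = (\<Sum>k\<in>A. (f k - (-1) ^ m * ((-1) ^ k * f k)) / 2)"
    by (intro sum.cong refl) (auto simp: uminus_power_if)
  finally show ?thesis
    by (simp add: sum_subtractf sum_distrib_left sum_divide_distrib[symmetric])
qed

lemma hbar_sq: "N \<ge> 2 \<Longrightarrow> (hbar N)\<^sup>2 = 4 / ((real N)\<^sup>2 - 1)"
proof -
  assume "N \<ge> 2"
  then have "(real N)\<^sup>2 \<ge> 1" by simp
  then show ?thesis by (simp add: hbar_def power_divide)
qed

theorem theorem3:
  fixes N :: nat
  assumes N: "N \<ge> 2"
    and id1: "\<And>j l. j \<in> {1..N - 1} \<Longrightarrow> l \<in> {1..N - 1} \<Longrightarrow> j \<noteq> l \<Longrightarrow>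
      (\<Sum>i = 1..N - 1. (2 * real i + 1) / lam i * (W3 N i j l)\<^sup>2)
        = 1 / (real N * \<bar>real j - real l\<bar> * (real j + real l + 1))"
    and id2: "\<And>j l. j \<in> {1..N - 1} \<Longrightarrow> l \<in> {1..N - 1} \<Longrightarrow>
      (\<Sum>i = 1..N - 1. (-1) ^ i * lam i * (2 * real i + 1) * (W3 N i j l)\<^sup>2)
        = (-1) ^ (N + 1) * (lam j + lam l) * W2 N l j"
    and id3: "\<And>j l. j \<in> {1..N - 1} \<Longrightarrow> l \<in> {1..N - 1} \<Longrightarrow>
      (\<Sum>i = 1..N - 1. lam i * (2 * real i + 1) * (W3 N i j l)\<^sup>2)
        = (((real N)\<^sup>2 - 1) * (lam j + lam l) - 2 * lam j * lam l) / (real N * ((real N)\<^sup>2 - 1))"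
    and id4: "\<And>j. j \<in> {1..N - 1} \<Longrightarrow>
      (\<Sum>i = 1..N - 1. (2 * real i + 1) / lam i * (1 / real N + (-1) ^ (i + j + N) * W2 N i j))
        = 2 * harm j / real N"
  shows "\<forall>l \<in> {1..N - 1}.
      ricci_neg N l = 2 * (harm l - 1) / (hbar N)\<^sup>2 \<and>
      2 * (harm l - 1) / (hbar N)\<^sup>2 = 2 * (harm l - 1) * (((real N)\<^sup>2 - 1) / 4) \<and>
      ricci_pos N l \<le> (4 * harm l + 2 * real l + 1) * (((real N)\<^sup>2 - 1) / 4)"
proof
  fix l assume l: "l \<in> {1..N - 1}"
  define n where "n = N - 1"
  have Nn: "real N = real n + 1" "N \<ge> 1" "N - 1 = n" using N by (auto simp: n_def)
  have N1: "(real N)\<^sup>2 - 1 > 0" using N by (simp add: power2_eq_square) (simp add: less_1_mult)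
  define x where "x k j = (W3 N k j l)\<^sup>2" for k j
  have x_sixj: "x k j = (sixj n (int k) (int j) (int l))\<^sup>2" for k j
    unfolding x_def W3_sq_eq_sixj_sq[OF Nn(2)] Nn(3) ..
  have x_rot: "(W3 N l k j)\<^sup>2 = x k j" "(W3 N k l j)\<^sup>2 = x k j" and x_sym: "x j k = x k j" for k j
    unfolding x_def W3_sq_eq_sixj_sq[OF Nn(2)]
    by (metis sixj_swap12 sixj_swap23)+
  define w where "w k = 2 * real k + 1" for k
  define odds where "odds j = {k \<in> {1..n}. odd (k + (j + l))}" for j
  \<comment> \<open>The sum over the indices of the right parity with weight 1: it is determined by
    orthogonality and the alternating sum.\<close>
  define P where "P j = (\<Sum>k \<in> odds j. w k * x k j)" for j
  have lam_pos: "lam k > 0" if "k \<in> {1..n}" for k using that by (simp add: lam_def)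
  have P_eq: "P j = (1 / real N + (-1) ^ (j + l + N) * W2 N j l) / 2" if j: "j \<in> {1..n}" for j
  proof -
    \<comment> \<open>Orthogonality includes \<open>k = 0\<close>, which the parity condition excludes: the symbol is zero
    unless \<open>j = l\<close>, and then \<open>0 + j + l\<close> is even.\<close>
    have x0: "odd (0 + (j + l)) \<Longrightarrow> x 0 j = 0"
      using sixj_inadmissible[of n 0 "int j" "int l"]
      by (cases "j = l") (auto simp: x_sixj sixj_admissible_def)
    have "P j = (\<Sum>k \<in> {k \<in> {0..n}. odd (k + (j + l))}. w k * x k j)"
      unfolding P_def odds_def using x0 by (intro sum.mono_neutral_left) (auto simp: Suc_le_eq intro!: gr0I)
    also have "\<dots> = ((\<Sum>k = 0..n. w k * x k j) - (-1) ^ (j + l) * (\<Sum>k = 0..n. (-1) ^ k * (w k * x k j))) / 2"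
      by (rule sum_odd_eq_half_difference) simp
    also have "(\<Sum>k = 0..n. w k * x k j) = 1 / real N"
      unfolding w_def x_sixj Nn(1) using j l Nn by (intro sixj_orthogonality) auto
    also have "(\<Sum>k = 0..n. (-1) ^ k * (w k * x k j)) = (-1) ^ (N + 1) * W2 N j l"
    proof -
      have "(lam j + lam l) * (\<Sum>k = 0..n. (-1) ^ k * (w k * x k j)) = (\<Sum>k = 0..n. (-1) ^ k * lam k * w k * x k j)"
        using sixj_alternating_sum[of j n l] j by (simp add: w_def x_sixj mult_ac)
      also have "\<dots> = (\<Sum>k = 1..n. (-1) ^ k * lam k * w k * x k j)"
        by (rule sum.mono_neutral_right) (auto simp: lam_def Suc_le_eq)
      also have "\<dots> = (-1) ^ (N + 1) * (lam l + lam j) * W2 N j l"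
        using id2[of l j] j l Nn(3) unfolding x_rot w_def by simp
      finally have "(lam j + lam l) * (\<Sum>k = 0..n. (-1) ^ k * (w k * x k j))
          = (lam j + lam l) * ((-1) ^ (N + 1) * W2 N j l)" by (simp add: algebra_simps)
      moreover have "lam j + lam l \<noteq> 0" using lam_pos[OF j] lam_pos[of l] l Nn(3) by simp
      ultimately show ?thesis using mult_left_cancel by blast
    qed
    finally show ?thesis by (simp add: power_add algebra_simps)
  qed
  \<comment> \<open>The same parity sum with weight \<open>lam k\<close> is almost \<open>lam j + lam l\<close> times \<open>P j\<close>, because
    the two hypotheses about weight \<open>lam\<close> share this factor.\<close>
  have Q_eq: "(\<Sum>k \<in> odds j. lam k * w k * x k j)
      = (lam j + lam l) * P j - lam j * lam l / (real N * ((real N)\<^sup>2 - 1))" if j: "j \<in> {1..n}" for j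
  proof -
    define q where "q = lam j * lam l / (real N * ((real N)\<^sup>2 - 1))"
    have "(\<Sum>k \<in> odds j. lam k * w k * x k j)
        = ((\<Sum>k = 1..n. lam k * w k * x k j) - (-1) ^ (j + l) * (\<Sum>k = 1..n. (-1) ^ k * (lam k * w k * x k j))) / 2"
      unfolding odds_def by (rule sum_odd_eq_half_difference) simp
    also have "(\<Sum>k = 1..n. lam k * w k * x k j)
        = (((real N)\<^sup>2 - 1) * (lam j + lam l) - 2 * lam j * lam l) / (real N * ((real N)\<^sup>2 - 1))"
      using id3[of j l] j l Nn(3) unfolding x_def w_def by simp
    also have "(\<Sum>k = 1..n. (-1) ^ k * (lam k * w k * x k j)) = (-1) ^ (N + 1) * (lam l + lam j) * W2 N j l"
      using id2[of l j] j l Nn(3) unfolding x_rot w_def by (simp add: mult_ac)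
    also have "(((real N)\<^sup>2 - 1) * (lam j + lam l) - 2 * lam j * lam l) / (real N * ((real N)\<^sup>2 - 1))
        = (lam j + lam l) * (1 / real N) - 2 * q"
      unfolding q_def using N1 by (simp add: diff_divide_distrib)
    finally show ?thesis unfolding P_eq[OF j] q_def[symmetric]
      by (simp add: power_add algebra_simps add_divide_distrib diff_divide_distrib)
  qed
  have sum_w: "(\<Sum>k = 1..n. w k) = (real N)\<^sup>2 - 1"
    unfolding w_def Nn(1) by (induction n) (simp_all add: power2_eq_square algebra_simps)
  \<comment> \<open>Expanding \<open>(lam k - lam k')\<^sup>2\<close> in the negative part gives \<open>2 * (S1 - S0) / lam l\<close>.\<close>
  define S0 where "S0 = (\<Sum>j = 1..n. \<Sum>k \<in> odds j. w j * w k * x k j)"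
  define S1 where "S1 = (\<Sum>j = 1..n. \<Sum>k \<in> odds j. lam k / lam j * w j * w k * x k j)"
  have S0: "S0 = (\<Sum>j = 1..n. w j * P j)"
    unfolding S0_def P_def by (simp add: sum_distrib_left mult_ac)
  have S1: "S1 = S0 + lam l * (harm l - 1) / real N"
  proof -
    have "S1 = (\<Sum>j = 1..n. w j / lam j * (\<Sum>k \<in> odds j. lam k * w k * x k j))"
      unfolding S1_def by (simp add: sum_distrib_left mult_ac)
    also have "\<dots> = (\<Sum>j = 1..n. w j * P j + lam l * (w j / lam j * P j) - lam l / (real N * ((real N)\<^sup>2 - 1)) * w j)"
    proof (intro sum.cong refl)
      fix j assume j: "j \<in> {1..n}"
      show "w j / lam j * (\<Sum>k \<in> odds j. lam k * w k * x k j)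
          = w j * P j + lam l * (w j / lam j * P j) - lam l / (real N * ((real N)\<^sup>2 - 1)) * w j"
        unfolding Q_eq[OF j] using lam_pos[OF j] by (simp add: field_simps)
    qed
    also have "\<dots> = S0 + lam l * (\<Sum>j = 1..n. w j / lam j * P j) - lam l / (real N * ((real N)\<^sup>2 - 1)) * ((real N)\<^sup>2 - 1)"
      unfolding S0 sum_w[symmetric] by (simp add: sum.distrib sum_subtractf sum_distrib_left)
    also have "(\<Sum>j = 1..n. w j / lam j * P j)
        = (\<Sum>j = 1..n. (2 * real j + 1) / lam j * (1 / real N + (-1) ^ (j + l + N) * W2 N j l)) / 2"
      unfolding sum_divide_distrib by (intro sum.cong refl) (simp add: P_eq w_def)
    also have "\<dots> = harm l / real N" using id4[OF l] Nn(3) by simp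
    also have "lam l / (real N * ((real N)\<^sup>2 - 1)) * ((real N)\<^sup>2 - 1) = lam l / real N"
      using N1 by simp
    finally show ?thesis by (simp add: algebra_simps diff_divide_distrib)
  qed
  have S1': "(\<Sum>j = 1..n. \<Sum>k \<in> odds j. lam j / lam k * w j * w k * x k j) = S1"
  proof -
    have "S1 = (\<Sum>j = 1..n. \<Sum>k = 1..n. if odd (k + (j + l)) then lam k / lam j * w j * w k * x k j else 0)"
      unfolding S1_def odds_def by (intro sum.cong refl sum.inter_filter) simp
    also have "\<dots> = (\<Sum>k = 1..n. \<Sum>j = 1..n. if odd (k + (j + l)) then lam k / lam j * w j * w k * x k j else 0)"
      by (rule sum.swap)
    also have "\<dots> = (\<Sum>k = 1..n. \<Sum>j = 1..n. if odd (j + (k + l)) then lam k / lam j * w k * w j * x j k else 0)"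
    proof (intro sum.cong refl)
      fix k j :: nat
      have "k + (j + l) = j + (k + l)" by simp
      then show "(if odd (k + (j + l)) then lam k / lam j * w j * w k * x k j else 0)
          = (if odd (j + (k + l)) then lam k / lam j * w k * w j * x j k else 0)"
        by (simp only: x_sym mult_ac)
    qed
    also have "\<dots> = (\<Sum>k = 1..n. \<Sum>j \<in> odds k. lam k / lam j * w k * w j * x j k)"
      unfolding odds_def by (intro sum.cong refl sum.inter_filter[symmetric]) simp
    finally show ?thesis ..
  qed
  have odds': "{k' \<in> {1..N - 1}. odd (k + k' + l)} = odds k" for k
    unfolding odds_def Nn(3) by (simp add: add_ac)
  have "ricci_neg N l = 2 * (harm l - 1) / (hbar N)\<^sup>2"
  proof -
    have "(\<Sum>k = 1..n. \<Sum>k' \<in> odds k. (lam k - lam k')\<^sup>2 / (lam k * lam k' * lam l) * w k * w k' * x k' k)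
        = (\<Sum>k = 1..n. \<Sum>k' \<in> odds k. (lam k' / lam k * w k * w k' * x k' k
            + lam k / lam k' * w k * w k' * x k' k - 2 * (w k * w k' * x k' k)) / lam l)"
    proof (intro sum.cong refl)
      fix k k' assume "k \<in> {1..n}" "k' \<in> odds k"
      then have "lam k > 0" "lam k' > 0" "lam l > 0" using lam_pos l Nn(3) by (auto simp: odds_def)
      then show "(lam k - lam k')\<^sup>2 / (lam k * lam k' * lam l) * w k * w k' * x k' k
          = (lam k' / lam k * w k * w k' * x k' k + lam k / lam k' * w k * w k' * x k' k
            - 2 * (w k * w k' * x k' k)) / lam l"
        by (simp add: divide_simps) (simp add: algebra_simps power2_eq_square)
    qed
    also have "\<dots> = ((\<Sum>k = 1..n. \<Sum>k' \<in> odds k. lam k' / lam k * w k * w k' * x k' k)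
          + (\<Sum>k = 1..n. \<Sum>k' \<in> odds k. lam k / lam k' * w k * w k' * x k' k)
          - 2 * (\<Sum>k = 1..n. \<Sum>k' \<in> odds k. w k * w k' * x k' k)) / lam l"
      by (simp only: sum.distrib sum_subtractf sum_distrib_left[symmetric] sum_divide_distrib[symmetric])
    also have "\<dots> = (S1 + S1 - 2 * S0) / lam l"
      unfolding S1' S1_def[symmetric] S0_def[symmetric] by (rule refl)
    also have "S1 + S1 - 2 * S0 = lam l * (2 * (harm l - 1) / real N)"
      unfolding S1 by simp
    also have "\<dots> / lam l = 2 * (harm l - 1) / real N"
      using lam_pos[of l] l Nn(3) by simp
    finally have "ricci_neg N l = real N / (hbar N)\<^sup>2 * (2 * (harm l - 1) / real N)"
      unfolding ricci_neg_def odds' x_rot unfolding w_def Nn(3) by (simp add: x_sym)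
    then show ?thesis using N by simp
  qed
  moreover have "2 * (harm l - 1) / (hbar N)\<^sup>2 = 2 * (harm l - 1) * (((real N)\<^sup>2 - 1) / 4)"
    unfolding hbar_sq[OF N] by simp
  moreover have "ricci_pos N l \<le> (4 * harm l + 2 * real l + 1) * (((real N)\<^sup>2 - 1) / 4)"
  proof -
    \<comment> \<open>For \<open>k \<noteq> l\<close> the parity condition may be dropped and the first identity applies. For
    \<open>k = l\<close> it is unavailable, but \<open>lam k' \<ge> 2\<close> reduces the bound to orthogonality.\<close>
    define R where "R k = (\<Sum>k' \<in> odds k. w k' / lam k' * x k' k)" for k
    have term_nonneg: "0 \<le> w k' / lam k' * x k' k" if "k' \<in> {1..n}" for k k'
      using lam_pos[OF that] by (simp add: w_def x_def)
    have R_off: "R k \<le> 1 / (real N * \<bar>real k - real l\<bar> * (real k + real l + 1))"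
      if "k \<in> {1..n} - {l}" for k
    proof -
      have "R k \<le> (\<Sum>k' = 1..n. w k' / lam k' * x k' k)"
        unfolding R_def odds_def by (rule sum_mono2) (auto simp del: times_divide_eq_left intro!: term_nonneg)
      also have "\<dots> = 1 / (real N * \<bar>real k - real l\<bar> * (real k + real l + 1))"
        using id1[of k l] that l Nn(3) unfolding w_def x_def by simp
      finally show ?thesis .
    qed
    have R_diag: "R l \<le> 1 / (2 * real N)"
    proof -
      have "R l \<le> (\<Sum>k' = 1..n. w k' / lam k' * x k' l)"
        unfolding R_def odds_def by (rule sum_mono2) (auto simp del: times_divide_eq_left intro!: term_nonneg)
      also have "\<dots> \<le> (\<Sum>k' = 1..n. w k' * x k' l / 2)"
      proof (rule sum_mono)
        fix k' assume "k' \<in> {1..n}"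
        then have "lam k' \<ge> 1 * (1 + 1)" unfolding lam_def by (intro mult_mono) auto
        then have "w k' * x k' l / lam k' \<le> w k' * x k' l / 2"
          by (intro divide_left_mono) (auto simp: w_def x_def)
        then show "w k' / lam k' * x k' l \<le> w k' * x k' l / 2" by simp
      qed
      also have "\<dots> \<le> (\<Sum>k' = 0..n. w k' * x k' l / 2)"
        by (rule sum_mono2) (auto simp: w_def x_def)
      also have "\<dots> = (1 / real N) / 2"
        unfolding sum_divide_distrib[symmetric] w_def x_sixj Nn(1) using l Nn(3) by (subst sixj_orthogonality) auto
      finally show ?thesis by simp
    qed
    have "(\<Sum>k = 1..n. \<Sum>k' \<in> odds k. lam l / (lam k * lam k') * w k * w k' * x k' k)
        = (\<Sum>k = 1..n. lam l * w k / lam k * R k)"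
      unfolding R_def by (simp add: sum_distrib_left mult_ac)
    also have "\<dots> = lam l * w l / lam l * R l + (\<Sum>k \<in> {1..n} - {l}. lam l * w k / lam k * R k)"
      using l Nn(3) by (intro sum.remove) auto
    also have "\<dots> \<le> w l / (2 * real N) + (\<Sum>k \<in> {1..n} - {l}. lam l * (2 * real k + 1)
        / (lam k * (\<bar>real k - real l\<bar> * (real k + real l + 1))) / real N)"
    proof (intro add_mono sum_mono)
      show "lam l * w l / lam l * R l \<le> w l / (2 * real N)"
        using R_diag lam_pos[of l] l Nn(3) mult_left_mono[OF R_diag, of "w l"] by (simp add: w_def)
      fix k assume k: "k \<in> {1..n} - {l}"
      have "lam l * w k / lam k * R k
          \<le> lam l * w k / lam k * (1 / (real N * \<bar>real k - real l\<bar> * (real k + real l + 1)))"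
        using R_off[OF k] by (rule mult_left_mono) (simp add: w_def lam_def)
      then show "lam l * w k / lam k * R k
          \<le> lam l * (2 * real k + 1) / (lam k * (\<bar>real k - real l\<bar> * (real k + real l + 1))) / real N"
        by (simp add: w_def mult_ac)
    qed
    also have "\<dots> \<le> (2 * real l + 1) / (2 * real N) + 4 * harm l / real N"
      unfolding sum_divide_distrib[symmetric] w_def using sum_resolvent_le_harm[of l n] l Nn(3)
      by (intro add_mono divide_right_mono) auto
    also have "\<dots> \<le> (4 * harm l + 2 * real l + 1) / real N"
      using N by (simp add: divide_simps)
    finally have "real N / (hbar N)\<^sup>2 * (\<Sum>k = 1..n. \<Sum>k' \<in> odds k. lam l / (lam k * lam k') * w k * w k' * x k' k)
        \<le> real N / (hbar N)\<^sup>2 * ((4 * harm l + 2 * real l + 1) / real N)"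
      by (rule mult_left_mono) simp
    then have "ricci_pos N l \<le> real N / (hbar N)\<^sup>2 * ((4 * harm l + 2 * real l + 1) / real N)"
      unfolding ricci_pos_def odds' x_rot unfolding w_def Nn(3) by (simp add: x_sym)
    then show ?thesis using N unfolding hbar_sq[OF N] by (simp add: mult.commute)
  qed
  ultimately show "ricci_neg N l = 2 * (harm l - 1) / (hbar N)\<^sup>2 \<and>
      2 * (harm l - 1) / (hbar N)\<^sup>2 = 2 * (harm l - 1) * (((real N)\<^sup>2 - 1) / 4) \<and>
      ricci_pos N l \<le> (4 * harm l + 2 * real l + 1) * (((real N)\<^sup>2 - 1) / 4)" by blast
qed

end
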